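(* Let $X$ be a hereditarily locally connected separable metrizable space (for example, an $\mathbb R$-tree). Then $\dim(\Lambda(Y))=\dim(Y)$ for every subspace $Y$ of $X$, where $\Lambda(Y)=\{y\in Y : Y \text{ is } 1\text{-dimensional at } y\}$. Thus $X$ does not contain a weakly $1$-dimensional space, i.e. no subspace of $X$ is weakly $1$-dimensional. In particular, these conclusions hold for every separable metrizable $\mathbb R$-tree $X$.
   Context: All spaces are separable and metrizable. $\dim$ denotes the usual topological dimension (for separable metrizable spaces the small inductive, large inductive and covering dimensions coincide), with the convention that the empty space is zero-dimensional, i.e. $\dim(\varnothing)=0$: a space is zero-dimensional if it has a neighbourhood basis of clopen sets, which holds vacuously for $\varnothing$. A connected space $X$ is hereditarily locally connected if every connected subspace of $X$ is locally connected. An $\mathbb R$-tree is a locally arcwise connected, uniquely arcwise connected space (uniquely arcwise connected: any two distinct points are the endpoints of exactly one arc in the space). A space $Y$ is zero-dimensional at $y\in Y$ if every neighbourhood of $y$ in $Y$ contains a clopen (in $Y$) neighbourhood of $y$. $Y$ is $1$-dimensional at $y$ if $Y$ is not zero-dimensional at $y$ but every neighbourhood of $y$ contains an open neighbourhood of $y$ whose boundary has dimension at most $0$. (If $\dim(Y)\le 1$, then $Y$ is $1$-dimensional at $y$ if and only if $Y$ is not zero-dimensional at $y$.) A space $Y$ is weakly $1$-dimensional if $\dim(Y)=1$ but $\dim(\Lambda(Y))=0$. *)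

theory Defs
  imports "HOL-Analysis.Analysis" "HOL-Library.Extended_Nat"
begin

(* Vacuously true of the empty space, so the empty space is zero-dimensional. *)
definition zero_dimensional_space :: "'a topology \<Rightarrow> bool" where
  "zero_dimensional_space X \<longleftrightarrow>
     neighbourhood_base_of (\<lambda>V. openin X V \<and> closedin X V) X"

(* Small inductive dimension, started at 0 (not at -1): by the convention that the
   empty space has dimension 0. *)
primrec dimension_le :: "nat \<Rightarrow> 'a topology \<Rightarrow> bool" where
  "dimension_le 0 X \<longleftrightarrow> zero_dimensional_space X"
| "dimension_le (Suc n) X \<longleftrightarrow>
     neighbourhood_base_of
       (\<lambda>V. openin X V \<and> dimension_le n (subtopology X (X frontier_of V))) X"

(* The infimum of the empty set is infinity, the value for infinite-dimensional spaces. *)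
definition top_dim :: "'a topology \<Rightarrow> enat" where
  "top_dim X = Inf {enat n |n. dimension_le n X}"

definition zero_dimensional_at :: "'a topology \<Rightarrow> 'a \<Rightarrow> bool" where
  "zero_dimensional_at Y y \<longleftrightarrow>
     neighbourhood_base_at y (\<lambda>V. openin Y V \<and> closedin Y V) Y"

definition one_dimensional_at :: "'a topology \<Rightarrow> 'a \<Rightarrow> bool" where
  "one_dimensional_at Y y \<longleftrightarrow>
     \<not> zero_dimensional_at Y y \<and>
     neighbourhood_base_at y
       (\<lambda>V. openin Y V \<and> top_dim (subtopology Y (Y frontier_of V)) \<le> 0) Y"

definition Lambda_set :: "'a topology \<Rightarrow> 'a set" where
  "Lambda_set Y = {y \<in> topspace Y. one_dimensional_at Y y}"

definition weakly_one_dimensional :: "'a topology \<Rightarrow> bool" where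
  "weakly_one_dimensional Y \<longleftrightarrow>
     top_dim Y = 1 \<and> top_dim (subtopology Y (Lambda_set Y)) = 0"

definition hereditarily_locally_connected_space :: "'a topology \<Rightarrow> bool" where
  "hereditarily_locally_connected_space X \<longleftrightarrow>
     connected_space X \<and>
     (\<forall>C. connectedin X C \<longrightarrow> locally_connected_space (subtopology X C))"

(* An arc is a subset of the space, not a parametrisation of it; this matters for
   the uniqueness of arcs below. *)
definition arc_between :: "'a topology \<Rightarrow> 'a set \<Rightarrow> 'a \<Rightarrow> 'a \<Rightarrow> bool" where
  "arc_between X A x y \<longleftrightarrow>
     (\<exists>g. embedding_map (top_of_set {0..1::real}) X g \<and>
          g ` {0..1} = A \<and> g 0 = x \<and> g 1 = y)"

definition arcwise_connectedin :: "'a topology \<Rightarrow> 'a set \<Rightarrow> bool" where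
  "arcwise_connectedin X S \<longleftrightarrow>
     S \<subseteq> topspace X \<and>
     (\<forall>x\<in>S. \<forall>y\<in>S. x \<noteq> y \<longrightarrow> (\<exists>A. A \<subseteq> S \<and> arc_between X A x y))"

definition locally_arcwise_connected_space :: "'a topology \<Rightarrow> bool" where
  "locally_arcwise_connected_space X \<longleftrightarrow>
     neighbourhood_base_of (arcwise_connectedin X) X"

definition uniquely_arcwise_connected_space :: "'a topology \<Rightarrow> bool" where
  "uniquely_arcwise_connected_space X \<longleftrightarrow>
     (\<forall>x\<in>topspace X. \<forall>y\<in>topspace X. x \<noteq> y \<longrightarrow> (\<exists>!A. arc_between X A x y))"

definition R_tree :: "'a topology \<Rightarrow> bool" where
  "R_tree X \<longleftrightarrow>
     locally_arcwise_connected_space X \<and> uniquely_arcwise_connected_space X"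

end

theory Submission
  imports Defs
begin

text \<open>
  Everything rests on one property of a hereditarily locally connected space: if pairwise disjoint
  connected open sets all meet a fixed connected set \<open>U\<close>, then they accumulate only at \<open>closure U\<close>
  and at their own closures; at any other accumulation point \<open>z\<close>, the connected set consisting of
  \<open>z\<close>, \<open>U\<close> and the given sets would fail to be locally connected.

  Suppose \<open>\<Lambda>(Y)\<close> is zero-dimensional and \<open>y \<in> \<Lambda>(Y)\<close>. Choose a small connected open \<open>U \<ni> y\<close>
  whose boundary misses \<open>\<Lambda>(Y)\<close>. The boundary points of \<open>U\<close> in \<open>Y\<close> are covered by small disjoint
  connected open sets meeting \<open>U\<close> whose boundaries miss \<open>Y\<close>; adding them to \<open>U\<close> yields an open set
  whose boundary misses \<open>Y\<close>. So \<open>Y\<close> is zero-dimensional at \<open>y\<close>.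

  That \<open>X\<close> is at most one-dimensional is seen from a Kadec-type argument. There are continuous
  functions \<open>g n\<close> with connected sublevel sets that form a base. For a continuous \<open>f\<close> and all but
  countably many \<open>t\<close>, every \<open>g n\<close> restricted to the level set \<open>f = t\<close> is lower semicontinuous for
  the topology generated by the clopen subsets of that level set. If moreover \<open>f\<close> is a weighted sum
  of all the \<open>g n\<close>, then, the sum being constant there, each \<open>g n\<close> is continuous for that topology,
  so that the level set is zero-dimensional.
\<close>

subsection \<open>Disjoint connected open sets meeting a connected set\<close>

text \<open>The set is empty when \<open>x\<close> lies outside \<open>S\<close> or outside the
  space, so the facts below can be stated for every \<open>x\<close>.\<close>

abbreviation component_in :: "'a topology \<Rightarrow> 'a set \<Rightarrow> 'a \<Rightarrow> 'a set" where
  "component_in X S x \<equiv> connected_component_of_set (subtopology X S) x"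

lemma component_in_subset: "component_in X S x \<subseteq> S"
  using connected_component_of_subset_topspace[of "subtopology X S" x] by auto

lemma connectedin_component_in: "connectedin X (component_in X S x)"
  using connectedin_connected_component_of[of "subtopology X S" x]
  by (simp add: connectedin_subtopology)

lemma mem_component_in: "x \<in> component_in X S x \<longleftrightarrow> x \<in> topspace X \<inter> S"
  by (simp add: connected_component_of_refl)

lemma openin_component_in:
  assumes "locally_connected_space X" "openin X S"
  shows "openin X (component_in X S x)"
proof (cases "x \<in> S")
  case True
  then show ?thesis
    using assms locally_connected_B by blast
next
  case False
  then have "component_in X S x = {}"
    by (subst connected_component_of_eq_empty) auto
  then show ?thesis by (metis openin_empty)
qed

text \<open>The component of a point \<open>z\<close> of \<open>S\<close> is an open neighbourhood
  of \<open>z\<close>. If \<open>z\<close> is in the closure of another component, the two meet and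
  hence coincide. Consequently the boundary of a component lies outside \<open>S\<close>, which is
  how boundary conditions pass from open sets to their components.\<close>

lemma closure_of_component_in:
  assumes "locally_connected_space X" "openin X S"
  shows "X closure_of component_in X S x \<inter> S \<subseteq> component_in X S x"
proof
  fix z assume z: "z \<in> X closure_of component_in X S x \<inter> S"
  have "z \<in> topspace X"
    using z closure_of_subset_topspace by fastforce
  then have "z \<in> component_in X S z" "openin X (component_in X S z)"
    using z assms mem_component_in openin_component_in by fastforce+
  then obtain w where "w \<in> component_in X S z" "w \<in> component_in X S x"
    using z by (metis IntD1 in_closure_of)
  then show "z \<in> component_in X S x"
    by (metis connected_component_of_sym connected_component_of_trans mem_Collect_eq)
qed

lemma component_in_eq_or_disjnt:
  "component_in X S x = component_in X S y \<or> disjnt (component_in X S x) (component_in X S y)"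
  by (metis connected_component_of_disjoint connected_component_of_equiv)

lemma hereditarily_locally_connected_imp_locally_connected:
  "hereditarily_locally_connected_space X \<Longrightarrow> locally_connected_space X"
  unfolding hereditarily_locally_connected_space_def
  by (metis connectedin_topspace subtopology_topspace)

text \<open>Every member of \<W> meets the connected set \<open>U\<close>, so \<open>U\<close> with
  all of \<W> is connected, and it stays connected when a single limit point \<open>z\<close> is
  added. Local connectedness at \<open>z\<close> gives a connected neighbourhood \<open>Q\<close> of
  \<open>z\<close> avoiding \<open>U\<close>. It reaches some member \<open>W\<close>, from which
  the rest of \<open>Q\<close>, including \<open>z\<close>, turns out to be separated.\<close>

lemma closure_of_connected_Un_disjoint_open:
  assumes hlc: "hereditarily_locally_connected_space X"
    and U: "connectedin X U"
    and op: "\<And>W. W \<in> \<W> \<Longrightarrow> openin X W"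
    and con: "\<And>W. W \<in> \<W> \<Longrightarrow> connectedin X W"
    and meet: "\<And>W. W \<in> \<W> \<Longrightarrow> W \<inter> U \<noteq> {}"
    and disj: "pairwise disjnt \<W>"
  shows "X closure_of (U \<union> \<Union>\<W>) \<subseteq> X closure_of U \<union> (\<Union>W\<in>\<W>. X closure_of W)"
proof (rule ccontr)
  assume "\<not> ?thesis"
  then obtain z where z: "z \<in> X closure_of (U \<union> \<Union>\<W>)" "z \<notin> X closure_of U"
    and zW: "\<And>W. W \<in> \<W> \<Longrightarrow> z \<notin> X closure_of W"
    by blast
  define G where "G = U \<union> \<Union>\<W>"
  have zt: "z \<in> topspace X"
    using z closure_of_subset_topspace by fastforce
  have subX: "U \<subseteq> topspace X" "\<And>W. W \<in> \<W> \<Longrightarrow> W \<subseteq> topspace X"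
    using U op by (auto simp: connectedin_subset_topspace openin_subset)
  then have Gt: "G \<subseteq> topspace X"
    by (auto simp: G_def)
  have zG: "z \<notin> G"
    using z zW closure_of_subset subX unfolding G_def by blast
  have "\<W> \<noteq> {}"
    using z by auto
  then obtain W0 where "W0 \<in> \<W>" by blast
  then obtain u where u: "u \<in> U" using meet by blast
  have G: "connectedin X G"
  proof -
    have "G = \<Union>((\<lambda>W. U \<union> W) ` \<W>)"
      using \<open>\<W> \<noteq> {}\<close> by (auto simp: G_def)
    moreover have "connectedin X (\<Union>((\<lambda>W. U \<union> W) ` \<W>))"
      using u U con meet by (intro connectedin_Union) (auto intro!: connectedin_Un)
    ultimately show ?thesis by simp
  qed
  define C where "C = insert z G"
  have "connectedin X C"
    using closure_of_subset[OF Gt] z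
    by (intro connectedin_intermediate_closure_of[OF G]) (auto simp: C_def G_def)
  then have "locally_connected_space (subtopology X C)"
    using hlc by (simp add: hereditarily_locally_connected_space_def)
  moreover have "openin (subtopology X C) (C \<inter> (topspace X - X closure_of U))"
    by (intro openin_subtopology_Int2 openin_diff) auto
  moreover have "z \<in> C \<inter> (topspace X - X closure_of U)"
    using z zt by (auto simp: C_def)
  ultimately obtain Q where Q: "openin (subtopology X C) Q" "connectedin (subtopology X C) Q"
      "z \<in> Q" "Q \<subseteq> C \<inter> (topspace X - X closure_of U)"
    unfolding locally_connected_space by meson
  then obtain P where P: "openin X P" "Q = P \<inter> C"
    by (auto simp: openin_subtopology)
  obtain g where g: "g \<in> P" "g \<in> G"
    using z P \<open>z \<in> Q\<close> by (metis G_def IntD1 in_closure_of)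
  have QU: "Q \<inter> U = {}"
    using Q(4) closure_of_subset[OF subX(1)] by blast
  have gQ: "g \<in> Q"
    using g P by (auto simp: C_def)
  with QU g obtain W where W: "W \<in> \<W>" "g \<in> W"
    by (auto simp: G_def)
  \<comment> \<open>Every other member of \<W> is disjoint from the open set \<open>W\<close> and
    thus lies in its exterior, as does \<open>z\<close> by assumption. So \<open>W\<close> and its
    exterior disconnect \<open>Q\<close>.\<close>
  have "Q \<subseteq> W \<union> (topspace X - X closure_of W)"
  proof
    fix q assume q: "q \<in> Q"
    show "q \<in> W \<union> (topspace X - X closure_of W)"
    proof (cases "q = z")
      case True
      then show ?thesis using zW W zt by auto
    next
      case False
      with q QU P obtain W' where W': "W' \<in> \<W>" "q \<in> W'"
        by (auto simp: C_def G_def)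
      show ?thesis
      proof (cases "W' = W")
        case True
        then show ?thesis using W' by auto
      next
        case False
        then have "W' \<inter> W = {}"
          using disj W W' by (meson disjnt_def pairwiseD)
        then have "W' \<inter> X closure_of W = {}"
          using op[OF W'(1)] by (simp add: openin_Int_closure_of_eq_empty)
        then show ?thesis using W' subX by blast
      qed
    qed
  qed
  moreover have "connectedin X Q"
    using Q(2) by (simp add: connectedin_subtopology)
  moreover have "W \<inter> (topspace X - X closure_of W) \<inter> Q = {}"
    using closure_of_subset[OF subX(2)[OF W(1)]] by blast
  ultimately show False
    using connectedinD[of X Q W "topspace X - X closure_of W"] op[OF W(1)] gQ W Q(3) zW zt
    by (metis (no_types, lifting) DiffI IntI closedin_closure_of empty_iff openin_closedin_eq openin_diff openin_topspace)
qed

subsection \<open>Points of zero-dimensionality\<close>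

text \<open>A relatively clopen piece \<open>A\<close> of \<open>M\<close> and its complement in
  \<open>M\<close> are separated in \<open>X\<close>, and separated sets in a metrizable space have
  disjoint open neighbourhoods \<open>P\<close> and \<open>Q\<close>. No point of
  \<open>M - A\<close> is then in the closure of \<open>P\<close>. The last conclusion says that the
  boundary of \<open>W\<close> misses \<open>M\<close>.\<close>

lemma zero_dimensional_at_subtopology_separation:
  assumes X: "metrizable_space X"
    and MX: "M \<subseteq> topspace X" and p: "p \<in> M" and zd: "zero_dimensional_at (subtopology X M) p"
    and V: "openin X V" "p \<in> V"
  obtains W where "openin X W" "p \<in> W" "X closure_of W \<subseteq> V" "X closure_of W \<inter> M \<subseteq> W"
proof -
  have "regular_space X"
    using X by (simp add: metrizable_imp_regular_space)
  then obtain V' where V': "openin X V'" "p \<in> V'" "X closure_of V' \<subseteq> V"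
    using V unfolding neighbourhood_base_of_closedin[symmetric] neighbourhood_base_of
    by (metis closure_of_minimal subset_trans)
  have "openin (subtopology X M) (V' \<inter> M)" "p \<in> V' \<inter> M"
    using V' p by (auto simp: openin_subtopology_Int)
  then obtain A where A: "openin (subtopology X M) A" "closedin (subtopology X M) A" "p \<in> A" "A \<subseteq> V' \<inter> M"
    using zd unfolding zero_dimensional_at_def neighbourhood_base_at_def by (meson subset_eq)
  have "closedin (subtopology X M) (M - A)"
    using A(1) MX by (metis closedin_diff closedin_topspace topspace_subtopology_subset)
  then have "separatedin (subtopology X M) A (M - A)"
    using A(2) by (simp add: separatedin_closed_sets disjnt_def)
  then have "separatedin X A (M - A)"
    by (simp add: separatedin_subtopology)
  then obtain P Q where PQ: "openin X P" "openin X Q" "A \<subseteq> P" "M - A \<subseteq> Q" "disjnt P Q"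
    using metrizable_space_separation[OF X] by metis
  show thesis
  proof
    show "openin X (P \<inter> V')"
      using PQ V' by blast
    show "p \<in> P \<inter> V'"
      using A PQ V' by blast
    show "X closure_of (P \<inter> V') \<subseteq> V"
      using V'(3) closure_of_mono[of "P \<inter> V'" V' X] by blast
    have "Q \<inter> X closure_of P = {}"
      using PQ by (metis disjnt_def inf_commute openin_Int_closure_of_eq_empty)
    then have "X closure_of (P \<inter> V') \<inter> M \<subseteq> A"
      using PQ(4) closure_of_mono[of "P \<inter> V'" P X] by blast
    then show "X closure_of (P \<inter> V') \<inter> M \<subseteq> P \<inter> V'"
      using A PQ by blast
  qed
qed

lemma second_countable_metrizable_separable:
  assumes "separable_space X" "metrizable_space X"
  shows "second_countable X"
proof -
  obtain M d where "Metric_space M d" and X: "X = Metric_space.mtopology M d"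
    using assms(2) unfolding metrizable_space_def by blast
  then interpret Metric_space M d by simp
  obtain C where C: "countable C" "C \<subseteq> M" "mtopology closure_of C = M"
    using assms(1) unfolding separable_space_def X by auto
  define \<B> where "\<B> = (\<lambda>(c,q). mball c (real_of_rat q)) ` (C \<times> UNIV)"
  have "countable \<B>"
    using C by (auto simp: \<B>_def)
  moreover have "\<exists>V\<in>\<B>. x \<in> V \<and> V \<subseteq> U" if U: "openin mtopology U" "x \<in> U" for U x
  proof -
    obtain r where r: "r > 0" "mball x r \<subseteq> U" "x \<in> M"
      using U by (metis openin_mtopology subsetD)
    then obtain q where q: "0 < real_of_rat q" "real_of_rat q < r/2"
      using of_rat_dense[of 0 "r/2"] by auto
    have "x \<in> mball x (of_rat q)"
      using r q by simp
    then obtain c where c: "c \<in> C" "c \<in> mball x (of_rat q)"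
      using C(3) r by (metis in_closure_of openin_mball)
    have "mball c (of_rat q) \<subseteq> U"
    proof (rule subset_trans[OF _ r(2)], rule mball_subset)
      show "d c x + of_rat q \<le> r"
        using c q by (simp add: commute)
    qed (use r in auto)
    moreover have "x \<in> mball c (of_rat q)"
      using c by (simp add: commute)
    ultimately show ?thesis
      using c by (auto simp: \<B>_def)
  qed
  ultimately show ?thesis
    unfolding second_countable_def X by (force simp: \<B>_def)
qed

text \<open>A neighbourhood of \<open>y\<close> whose boundary misses \<open>L\<close> has, within
  \<open>Y\<close>, only boundary points at which \<open>Y\<close> is zero-dimensional. Each of
  these can be absorbed by a small set with boundary off \<open>Y\<close>. Infinitely many such sets
  could create new boundary points in the limit; arranging them to be disjoint, connected and in
  contact with \<open>U\<close> excludes this by the closure lemma above.\<close>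

lemma zero_dimensional_at_of_zero_dimensional_subset:
  assumes hlc: "hereditarily_locally_connected_space X"
    and X: "separable_space X" "metrizable_space X"
    and YX: "Y \<subseteq> topspace X"
    and L: "\<And>p. p \<in> Y - L \<Longrightarrow> zero_dimensional_at (subtopology X Y) p"
    and LY: "L \<subseteq> Y" and y: "y \<in> L" "zero_dimensional_at (subtopology X L) y"
  shows "zero_dimensional_at (subtopology X Y) y"
  unfolding zero_dimensional_at_def neighbourhood_base_at_def
proof (intro allI impI)
  have lc: "locally_connected_space X"
    using hlc by (rule hereditarily_locally_connected_imp_locally_connected)
  fix V0 assume "openin (subtopology X Y) V0 \<and> y \<in> V0"
  then obtain V where V: "openin X V" "y \<in> V" "V \<inter> Y = V0"
    by (auto simp: openin_subtopology)
  obtain U0 where U0: "openin X U0" "y \<in> U0" "X closure_of U0 \<subseteq> V" "X closure_of U0 \<inter> L \<subseteq> U0"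
    using zero_dimensional_at_subtopology_separation[OF X(2) _ y V(1,2)] LY YX by blast
  define U where "U = component_in X U0 y"
  have U: "openin X U" "connectedin X U" "y \<in> U" "U \<subseteq> U0" "X closure_of U \<inter> U0 \<subseteq> U"
    using openin_component_in[OF lc U0(1)] connectedin_component_in component_in_subset[of X U0]
      closure_of_component_in[OF lc U0(1)] U0(2) LY YX y
    unfolding U_def mem_component_in by auto
  have clU: "X closure_of U \<subseteq> X closure_of U0"
    using U(4) by (rule closure_of_mono)
  \<comment> \<open>\<open>E\<close> misses \<open>L\<close>: a point of \<open>L\<close> in the
    closure of \<open>U\<close> lies in \<open>U0\<close> by the choice of \<open>U0\<close>, and a
    component of \<open>U0\<close> contains all its closure points in \<open>U0\<close>.\<close>
  define E where "E = X closure_of U \<inter> Y - U"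
  have "\<exists>W. openin X W \<and> p \<in> W \<and> X closure_of W \<subseteq> V \<and> X closure_of W \<inter> Y \<subseteq> W" if p: "p \<in> E" for p
  proof -
    have p': "p \<in> Y - L" "p \<in> V"
      using p U0 U clU by (auto simp: E_def)
    then have "p \<in> Y" by simp
    show ?thesis
      by (rule zero_dimensional_at_subtopology_separation[OF X(2) YX \<open>p \<in> Y\<close> L[OF p'(1)] V(1) p'(2)]) blast
  qed
  then obtain w where w: "\<And>p. p \<in> E \<Longrightarrow> openin X (w p) \<and> p \<in> w p \<and> X closure_of (w p) \<subseteq> V \<and> X closure_of (w p) \<inter> Y \<subseteq> w p"
    by metis
  have "Lindelof_space (subtopology X E)"
    using X by (simp add: second_countable_imp_Lindelof_space second_countable_metrizable_separable second_countable_subtopology)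
  then obtain \<V> where \<V>: "countable \<V>" "\<V> \<subseteq> w ` E" "E \<subseteq> \<Union>\<V>"
  proof -
    have "E \<subseteq> topspace X"
      using YX by (auto simp: E_def)
    moreover have "\<forall>U\<in>w ` E. openin X U" "E \<subseteq> \<Union>(w ` E)"
      using w by blast+
    ultimately show ?thesis
      using that \<open>Lindelof_space (subtopology X E)\<close> unfolding Lindelof_space_subtopology_subset[OF \<open>E \<subseteq> topspace X\<close>]
      by meson
  qed
  \<comment> \<open>Inserting the empty set keeps the enumerated family nonempty even when
    \<open>E\<close>, and with it \<V>, is empty.\<close>
  define N where "N n = from_nat_into (insert {} \<V>) n" for n
  have N: "openin X (N n)" "N n \<subseteq> V" "X closure_of N n \<inter> Y \<subseteq> N n" for n
  proof -
    have "N n \<in> insert {} \<V>"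
      unfolding N_def by (rule from_nat_into) simp
    then consider "N n = {}" | p where "p \<in> E" "N n = w p"
      using \<V>(2) by blast
    then have "openin X (N n) \<and> N n \<subseteq> V \<and> X closure_of N n \<inter> Y \<subseteq> N n"
    proof cases
      case (2 p)
      then show ?thesis
        using w[of p] closure_of_subset[of "w p" X] openin_subset[of X "w p"] by auto
    qed auto
    then show "openin X (N n)" "N n \<subseteq> V" "X closure_of N n \<inter> Y \<subseteq> N n" by auto
  qed
  have EN: "\<exists>n. e \<in> N n" if "e \<in> E" for e
    using that \<V> from_nat_into_surj[of "insert {} \<V>"] unfolding N_def
    by (metis UnionE countable_insert insertI2 subset_iff)
  \<comment> \<open>Removing closures keeps \<open>D n\<close> open. On \<open>Y\<close> this
    removes no more than the earlier \<open>N m\<close> themselves, since the closure of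
    \<open>N m\<close> meets \<open>Y\<close> only inside \<open>N m\<close>. Hence the sets
    \<open>D n\<close> cover \<open>E\<close> and their boundaries still miss
    \<open>Y\<close>.\<close>
  define D where "D n = N n - (\<Union>m<n. X closure_of N m)" for n
  have D: "openin X (D n)" for n
    unfolding D_def using N by (intro openin_diff closedin_Union) auto
  have clD: "X closure_of (D n) \<inter> Y \<subseteq> D n" for n
  proof
    fix z assume z: "z \<in> X closure_of (D n) \<inter> Y"
    then have "z \<in> N n"
      using N(3)[of n] closure_of_mono[of "D n" "N n" X] by (auto simp: D_def)
    moreover have "z \<notin> X closure_of N m" if "m < n" for m
    proof
      assume "z \<in> X closure_of N m"
      then have "z \<in> N m" using z N(3) by blast
      moreover have "N m \<inter> D n = {}"
        using that closure_of_subset[OF openin_subset[OF N(1)[of m]]] by (auto simp: D_def)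
      ultimately show False
        using z N(1)[of m] openin_Int_closure_of_eq_empty by fastforce
    qed
    ultimately show "z \<in> D n" by (auto simp: D_def)
  qed
  have disjD: "D m \<inter> D n = {}" if "m < n" for m n
    using that closure_of_subset[OF openin_subset[OF N(1)[of m]]] by (auto simp: D_def)
  \<comment> \<open>Components supply connected sets, and only those touching \<open>U\<close> are
    kept. None that is needed for \<open>E\<close> is lost: the component of a point of
    \<open>E\<close> is an open set around a point of the closure of \<open>U\<close>, so it meets
    \<open>U\<close>.\<close>
  define \<W> where "\<W> = {component_in X (D n) x | n x. component_in X (D n) x \<inter> U \<noteq> {}}"
  define G where "G = U \<union> \<Union>\<W>"
  have \<W>: "openin X W" "connectedin X W" "W \<inter> U \<noteq> {}" "W \<subseteq> V" "X closure_of W \<inter> Y \<subseteq> W" if "W \<in> \<W>" for W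
  proof -
    obtain n x where W: "W = component_in X (D n) x" "W \<inter> U \<noteq> {}"
      using \<open>W \<in> \<W>\<close> unfolding \<W>_def by blast
    show "openin X W" "W \<inter> U \<noteq> {}"
      using W openin_component_in[OF lc D] by simp_all
    show "connectedin X W"
      unfolding W(1) by (rule connectedin_component_in)
    have WD: "W \<subseteq> D n"
      using W component_in_subset by metis
    then show "W \<subseteq> V"
      using N(2)[of n] by (auto simp: D_def)
    have "X closure_of W \<inter> Y \<subseteq> X closure_of W \<inter> D n"
      using clD[of n] closure_of_mono[OF WD] by blast
    then show "X closure_of W \<inter> Y \<subseteq> W"
      using closure_of_component_in[OF lc D] W by blast
  qed
  have "pairwise disjnt \<W>"
  proof (rule pairwiseI)
    fix W W' assume W: "W \<in> \<W>" "W' \<in> \<W>" "W \<noteq> W'"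
    then obtain n x n' x' where *: "W = component_in X (D n) x" "W' = component_in X (D n') x'"
      unfolding \<W>_def by blast
    then have sub: "W \<subseteq> D n" "W' \<subseteq> D n'"
      using component_in_subset by metis+
    show "disjnt W W'"
    proof (cases n n' rule: linorder_cases)
      case equal
      then show ?thesis using * W(3) component_in_eq_or_disjnt by metis
    qed (use sub disjD[of n n'] disjD[of n' n] in \<open>auto simp: disjnt_def\<close>)
  qed
  then have "X closure_of G \<subseteq> X closure_of U \<union> (\<Union>W\<in>\<W>. X closure_of W)"
    unfolding G_def by (intro closure_of_connected_Un_disjoint_open[OF hlc U(2)] \<W>)
  moreover have "E \<subseteq> \<Union>\<W>"
  proof
    fix e assume e: "e \<in> E"
    define n where "n = (LEAST n. e \<in> N n)"
    have n: "e \<in> N n" "\<And>m. m < n \<Longrightarrow> e \<notin> N m"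
      using EN[OF e] not_less_Least unfolding n_def by (auto intro: LeastI)
    have "e \<in> Y"
      using e by (simp add: E_def)
    then have "e \<in> D n"
      using n N(3) unfolding D_def by blast
    then have "e \<in> component_in X (D n) e"
      using e YX by (subst mem_component_in) (auto simp: E_def)
    moreover have "e \<in> X closure_of U"
      using e by (simp add: E_def)
    ultimately have "component_in X (D n) e \<inter> U \<noteq> {}"
      using openin_component_in[OF lc D, of n e] by (metis disjoint_iff in_closure_of)
    then show "e \<in> \<Union>\<W>"
      using \<open>e \<in> component_in X (D n) e\<close> unfolding \<W>_def by blast
  qed
  ultimately have clG: "X closure_of G \<inter> Y \<subseteq> G"
    using \<W>(5) unfolding G_def E_def by blast
  have opG: "openin X G"
    unfolding G_def using U \<W> by blast
  have "X closure_of G \<inter> Y = G \<inter> Y"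
    using clG closure_of_subset[OF openin_subset[OF opG]] by blast
  then have "closedin (subtopology X Y) (G \<inter> Y)"
    by (metis closedin_closure_of closedin_subtopology)
  moreover have "openin (subtopology X Y) (G \<inter> Y)"
    using opG by (rule openin_subtopology_Int)
  moreover have "G \<inter> Y \<subseteq> V0"
  proof -
    have "U \<subseteq> V"
      using U(4) U0(3) closure_of_subset[OF openin_subset[OF U0(1)]] by blast
    then show ?thesis
      using \<W>(4) V by (auto simp: G_def)
  qed
  moreover have "y \<in> G \<inter> Y"
    using U(3) y LY by (auto simp: G_def)
  ultimately show "\<exists>U Va. openin (subtopology X Y) U \<and> (openin (subtopology X Y) Va \<and> closedin (subtopology X Y) Va) \<and> y \<in> U \<and> U \<subseteq> Va \<and> Va \<subseteq> V0"
    by blast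
qed

subsection \<open>Zero-dimensional level sets\<close>

text \<open>A bad level \<open>t\<close> has a point \<open>z\<close>, away from \<open>B\<close>,
  that thin strips around the level always connect to \<open>B\<close>. With uncountably many bad
  levels, the chosen points of some of them accumulate at the chosen point of another level
  \<open>s\<close>. Disjoint strips then give disjoint connected open sets that meet
  \<open>B\<close> and accumulate at \<open>z s\<close>, contrary to the closure lemma for connected
  sets.\<close>

lemma countable_levels_with_large_components:
  assumes hlc: "hereditarily_locally_connected_space X"
    and sc: "second_countable X"
    and B: "connectedin X B" and f: "continuous_map X euclideanreal f"
  defines "S \<equiv> \<lambda>t e. {x \<in> topspace X. f x \<in> {t - e<..<t + e}}"
  shows "countable (f ` {z \<in> topspace X - X closure_of B. \<forall>e>0. component_in X (S (f z) e) z \<inter> B \<noteq> {}})"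
    (is "countable (f ` ?Z)")
proof (rule ccontr)
  assume unc: "uncountable (f ` ?Z)"
  have lc: "locally_connected_space X"
    using hlc by (rule hereditarily_locally_connected_imp_locally_connected)
  have opS: "openin X (S t e)" for t e
    unfolding S_def by (rule openin_continuous_map_preimage[OF f]) auto
  define T where "T = f ` ?Z"
  define z where "z = inv_into ?Z f"
  have z: "z t \<in> topspace X - X closure_of B" "f (z t) = t"
      "e > 0 \<Longrightarrow> component_in X (S t e) (z t) \<inter> B \<noteq> {}" if "t \<in> T" for t e
  proof -
    have "z t \<in> ?Z" and ft: "f (z t) = t"
      using that unfolding T_def z_def by (rule inv_into_into, rule f_inv_into_f)
    then show "z t \<in> topspace X - X closure_of B" "e > 0 \<Longrightarrow> component_in X (S t e) (z t) \<inter> B \<noteq> {}"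
      unfolding mem_Collect_eq ft by blast+
  qed (use that in \<open>simp add: T_def z_def f_inv_into_f\<close>)
  obtain \<B> where \<B>': "countable \<B> \<and> (\<forall>V \<in> \<B>. openin X V) \<and>
      (\<forall>U x. openin X U \<and> x \<in> U \<longrightarrow> (\<exists>V \<in> \<B>. x \<in> V \<and> V \<subseteq> U))"
    using sc unfolding second_countable_def by (rule exE)
  then have \<B>: "countable \<B>" "\<And>V. V \<in> \<B> \<Longrightarrow> openin X V"
      "\<And>U x. openin X U \<Longrightarrow> x \<in> U \<Longrightarrow> \<exists>V\<in>\<B>. x \<in> V \<and> V \<subseteq> U"
    by simp_all
  \<comment> \<open>Otherwise every \<open>z s\<close> would have a basic neighbourhood containing
    no other chosen point, which would inject the uncountable \<open>T\<close> into the countable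
    base.\<close>
  have "\<exists>s\<in>T. \<forall>V\<in>\<B>. z s \<in> V \<longrightarrow> (\<exists>t\<in>T. t \<noteq> s \<and> z t \<in> V)"
  proof (rule ccontr)
    assume contra: "\<not> ?thesis"
    have "\<exists>V. V \<in> \<B> \<and> z s \<in> V \<and> (\<forall>t\<in>T. z t \<in> V \<longrightarrow> t = s)" if "s \<in> T" for s
    proof -
      have "\<not> (\<forall>V\<in>\<B>. z s \<in> V \<longrightarrow> (\<exists>t\<in>T. t \<noteq> s \<and> z t \<in> V))"
        using contra that by (simp only: bex_simps ball_simps not_all not_ex)
      then show ?thesis by meson
    qed
    then obtain v where v: "\<And>s. s \<in> T \<Longrightarrow> v s \<in> \<B> \<and> z s \<in> v s \<and> (\<forall>t\<in>T. z t \<in> v s \<longrightarrow> t = s)"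
      by metis
    have "inj_on v T"
      by (rule inj_onI) (metis v)
    moreover have "v ` T \<subseteq> \<B>"
      using v by blast
    ultimately show False
      using unc[folded T_def] \<B>(1) countable_image_inj_on countable_subset by metis
  qed
  then obtain s where s: "s \<in> T" and acc\<B>: "\<forall>V\<in>\<B>. z s \<in> V \<longrightarrow> (\<exists>t\<in>T. t \<noteq> s \<and> z t \<in> V)"
    by (rule bexE)
  have acc: "\<exists>t\<in>T. t \<noteq> s \<and> z t \<in> V" if "openin X V" "z s \<in> V" for V
    using \<B>(3)[OF that] acc\<B> by (meson subsetD)
  have zs: "z s \<in> topspace X" "f (z s) = s"
    using z[OF s] by auto
  obtain V :: "nat \<Rightarrow> 'a set" where V: "\<And>n. openin X (V n)" "\<And>n. z s \<in> V n" 
      "\<And>U. openin X U \<Longrightarrow> z s \<in> U \<Longrightarrow> \<exists>n. V n \<subseteq> U"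
  proof -
    define \<C> where "\<C> = {V\<in>\<B>. z s \<in> V}"
    have "\<C> \<noteq> {}"
      using \<B>(3)[OF openin_topspace zs(1)] by (auto simp: \<C>_def)
    have "countable \<C>"
      using \<B>(1) by (auto simp: \<C>_def)
    show ?thesis
    proof (intro that[of "from_nat_into \<C>"])
      show "openin X (from_nat_into \<C> n)" "z s \<in> from_nat_into \<C> n" for n
        using from_nat_into[OF \<open>\<C> \<noteq> {}\<close>, of n] \<B>(2) by (auto simp: \<C>_def)
      show "\<exists>n. from_nat_into \<C> n \<subseteq> U" if U: "openin X U" "z s \<in> U" for U
      proof -
        obtain V where "V \<in> \<C>" "V \<subseteq> U"
          using \<B>(3)[OF U] by (auto simp: \<C>_def)
        then show ?thesis
          using from_nat_into_surj[OF \<open>countable \<C>\<close>] by metis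
      qed
    qed
  qed
  have ex: "\<exists>t. t \<in> T \<and> t \<noteq> s \<and> z t \<in> V n \<and> \<bar>t - s\<bar> < r" if "r > 0" for n r
  proof -
    have "openin X (V n \<inter> S s r)" "z s \<in> V n \<inter> S s r"
      using V opS zs that by (auto simp: S_def)
    then obtain t where "t \<in> T" "t \<noteq> s" "z t \<in> V n \<inter> S s r"
      using acc by meson
    moreover have "f (z t) = t"
      using z[OF \<open>t \<in> T\<close>] by simp
    ultimately show ?thesis
      by (auto simp: S_def abs_less_iff intro!: exI[of _ t])
  qed
  define nx where "nx n r = (SOME t. t \<in> T \<and> t \<noteq> s \<and> z t \<in> V n \<and> \<bar>t - s\<bar> < r)" for n r
  have nxt: "nx n r \<in> T \<and> nx n r \<noteq> s \<and> z (nx n r) \<in> V n \<and> \<bar>nx n r - s\<bar> < r" if "r > 0" for n r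
    unfolding nx_def using ex[OF that] by (rule someI_ex)
  \<comment> \<open>Each level is less than a third as far from \<open>s\<close> as the one before,
    and its chosen point lies in \<open>V n\<close>. Since every neighbourhood of \<open>z s\<close>
    contains some \<open>V n\<close>, the point \<open>z s\<close> is in the closure of the chosen
    points.\<close>
  define t where "t = rec_nat (nx 0 1) (\<lambda>n u. nx (Suc n) (\<bar>u - s\<bar> / 3))"
  have t: "t n \<in> T \<and> t n \<noteq> s \<and> z (t n) \<in> V n" for n
    by (induction n) (use nxt in \<open>auto simp: t_def\<close>)
  define r where "r n = \<bar>t n - s\<bar>" for n
  have rpos: "r n > 0" for n
    using t[of n] by (simp add: r_def)
  have rSuc: "r (Suc n) < r n / 3" for n
    using nxt[of "\<bar>t n - s\<bar> / 3" "Suc n"] rpos[of n] by (simp add: r_def t_def)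
  have rless: "r n < r m / 3" if "m < n" for m n
    using that
  proof (induction n)
    case (Suc n)
    then show ?case
      using rSuc[of n] rpos[of n] by (cases "m = n") auto
  qed simp
  \<comment> \<open>The strip of half-width \<open>r n / 2\<close> puts the values of
    \<open>\<bar>f x - s\<bar>\<close> strictly between \<open>r n / 2\<close> and
    \<open>3/2 * r n\<close>. These ranges are disjoint for different \<open>n\<close> because the
    radii shrink by more than a factor 3, and the positive lower bound keeps \<open>z s\<close> out
    of the closure of each \<open>W n\<close>.\<close>
  define W where "W n = component_in X (S (t n) (r n / 2)) (z (t n))" for n
  have zt: "f (z (t n)) = t n" "z (t n) \<in> topspace X" for n
    using z t by blast+
  have Wsub: "W n \<subseteq> S (t n) (r n / 2)" for n
    unfolding W_def by (rule component_in_subset)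
  have Wf: "r n / 2 < \<bar>f x - s\<bar>" "\<bar>f x - s\<bar> < 3/2 * r n" if "x \<in> W n" for x n
  proof -
    have "\<bar>f x - t n\<bar> < r n / 2"
    proof -
      have "x \<in> S (t n) (r n / 2)"
        using that Wsub by blast
      then show ?thesis
        unfolding S_def by (simp only: mem_Collect_eq greaterThanLessThan_iff) linarith
    qed
    then show "r n / 2 < \<bar>f x - s\<bar>" "\<bar>f x - s\<bar> < 3/2 * r n"
      unfolding r_def by (simp_all add: abs_if split: if_splits)
  qed
  have opW: "openin X (W n)" for n
    unfolding W_def by (rule openin_component_in[OF lc opS])
  have zW: "z (t n) \<in> W n" for n
    using zt rpos[of n] unfolding W_def mem_component_in by (simp add: S_def)
  have "X closure_of (B \<union> \<Union>(range W)) \<subseteq> X closure_of B \<union> (\<Union>w\<in>range W. X closure_of w)"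
  proof (rule closure_of_connected_Un_disjoint_open[OF hlc B])
    show "openin X w" "connectedin X w" "w \<inter> B \<noteq> {}" if "w \<in> range W" for w
    proof -
      from that obtain n where w: "w = W n" by auto
      show "openin X w" using opW w by simp
      show "connectedin X w" unfolding w W_def by (rule connectedin_component_in)
      show "w \<inter> B \<noteq> {}"
        using z(3)[of "t n" "r n / 2"] t[of n] rpos[of n] unfolding w W_def by simp
    qed
    have "W m \<inter> W n = {}" if "m < n" for m n
      using Wf[of _ m] Wf[of _ n] rless[OF that] by fastforce
    then have "disjnt (W m) (W n)" if "m \<noteq> n" for m n
      using that unfolding disjnt_def by (metis inf_commute linorder_neqE_nat)
    then show "pairwise disjnt (range W)"
      by (metis (no_types, lifting) pairwiseI rangeE)
  qed
  moreover have "z s \<in> X closure_of (B \<union> \<Union>(range W))"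
    unfolding in_closure_of
  proof (intro conjI allI impI zs)
    fix U assume U: "z s \<in> U \<and> openin X U"
    then obtain n where "V n \<subseteq> U" using V(3) by blast
    then have "z (t n) \<in> U" using t by blast
    then show "\<exists>y. y \<in> B \<union> \<Union>(range W) \<and> y \<in> U"
      using zW by blast
  qed
  moreover have "z s \<notin> X closure_of W n" for n
  proof
    assume "z s \<in> X closure_of W n"
    moreover have "openin X (S s (r n / 2))" "z s \<in> S s (r n / 2)"
      using opS zs rpos[of n] by (auto simp: S_def)
    ultimately obtain y where "y \<in> W n" "y \<in> S s (r n / 2)"
      by (auto simp: in_closure_of)
    then show False
      using Wf(1)[of y n] unfolding S_def by (simp add: abs_if split: if_splits)
  qed
  moreover have "z s \<notin> X closure_of B"
    using z[OF s] by blast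
  ultimately show False by blast
qed

text \<open>For a centre \<open>y\<close>, the function measures how large a ball about
  \<open>y\<close> must be for its component at \<open>y\<close> to contain the given point. Its
  sublevel sets below the cap are increasing unions of connected sets through \<open>y\<close>.
  Letting \<open>y\<close> range over a countable dense set makes small sublevel sets a
  base.\<close>

lemma connected_sublevel_functions:
  assumes X: "separable_space X" "metrizable_space X"
    and con: "connected_space X" and lc: "locally_connected_space X"
  obtains g :: "nat \<Rightarrow> 'a \<Rightarrow> real" where
    "\<And>n. continuous_map X euclideanreal (g n)"
    "\<And>n x. g n x \<in> {0..1}"
    "\<And>n c. connectedin X {x \<in> topspace X. g n x < c}"
    "\<And>U x. openin X U \<Longrightarrow> x \<in> U \<Longrightarrow> \<exists>n c. g n x < c \<and> {x \<in> topspace X. g n x < c} \<subseteq> U"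
proof (cases "topspace X = {}")
  case True
  then have "X = discrete_topology {}"
    by (metis discrete_topology_unique empty_iff)
  then show ?thesis
    by (intro that[of "\<lambda>_ _. 0"]) auto
next
  case False
  obtain M d where "Metric_space M d" and XM: "X = Metric_space.mtopology M d"
    using X(2) unfolding metrizable_space_def by blast
  then interpret Metric_space M d by simp
  obtain C where C: "countable C" "C \<subseteq> M" "mtopology closure_of C = M"
    using X(1) unfolding separable_space_def XM by auto
  have "C \<noteq> {}"
    using False C by (auto simp: XM)
  have lcM: "locally_connected_space mtopology" and conM: "connectedin mtopology M"
    using con lc unfolding XM by (simp_all flip: connectedin_topspace)
  define K where "K y r = component_in mtopology (mball y r) y" for y r
  have KM: "K y r \<subseteq> mball y r" and Kcon: "connectedin mtopology (K y r)" and Kop: "openin mtopology (K y r)"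
    and Kmem: "y \<in> K y r \<longleftrightarrow> y \<in> M \<and> r > 0" for y r
    unfolding K_def using component_in_subset[of mtopology "mball y r"] connectedin_component_in
      openin_component_in[OF lcM openin_mball] by (auto simp: connected_component_of_refl)
  have Kmax: "S \<subseteq> K y r" if "connectedin mtopology S" "y \<in> S" "S \<subseteq> mball y r" for S y r
    unfolding K_def using that by (intro connected_component_of_maximal) (auto simp: connectedin_subtopology)
  have Kpos: "r > 0" if "z \<in> K y r" for y z r
    using that KM[of y r] by (metis in_mball order.strict_trans1 nonneg subsetD)
  \<comment> \<open>The element 1 caps the function and keeps the set under the infimum
    nonempty.\<close>
  define h where "h y z = Inf (insert 1 {r. z \<in> K y r})" for y z
  have bdd: "bdd_below (insert 1 {r. z \<in> K y r})" for y z
    using Kpos by (intro bdd_belowI[of _ 0]) (auto intro: less_imp_le)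
  have h_less: "h y z < c \<longleftrightarrow> 1 < c \<or> (\<exists>r<c. z \<in> K y r)" for y z c
    unfolding h_def by (subst cInf_less_iff[OF _ bdd]) auto
  have h01: "h y z \<in> {0..1}" for y z
  proof -
    have "\<not> h y z < 0"
      unfolding h_less using Kpos by (auto simp: not_less dest: less_imp_le)
    moreover have "h y z \<le> 1"
      unfolding h_def by (intro cInf_lower bdd) auto
    ultimately show ?thesis by auto
  qed
  \<comment> \<open>Beyond the cap the sublevel set is the whole space; this is where connectedness
    of \<open>X\<close> itself enters.\<close>
  have sub: "{z \<in> M. h y z < c} = (if 1 < c then M else \<Union>(K y ` {0<..<c}))" for y c
  proof -
    have "(\<exists>r<c. z \<in> K y r) \<longleftrightarrow> z \<in> \<Union>(K y ` {0<..<c})" for z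
      by (meson Kpos UN_iff greaterThanLessThan_iff)
    moreover have "\<Union>(K y ` {0<..<c}) \<subseteq> M"
      using KM by fastforce
    ultimately show ?thesis
      unfolding h_less by auto
  qed
  have hcon: "connectedin mtopology {z \<in> M. h y z < c}" if "y \<in> M" for y c
  proof -
    have "connectedin mtopology (\<Union>(K y ` {0<..<c}))"
    proof (rule connectedin_Union)
      have "y \<in> \<Inter>(K y ` {0<..<c})"
        using Kmem that by auto
      then show "\<Inter>(K y ` {0<..<c}) \<noteq> {}" by blast
    qed (use Kcon in auto)
    then show ?thesis
      unfolding sub using conM by simp
  qed
  have hcont: "continuous_map mtopology euclideanreal (h y)" for y
    unfolding continuous_map_upper_lower_semicontinuous_lt topspace_mtopology
  proof (intro conjI allI)
    show "openin mtopology {z \<in> M. h y z < c}" for c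
      unfolding sub using Kop openin_topspace[of mtopology] by auto
    show "openin mtopology {z \<in> M. c < h y z}" for c
    proof (subst openin_subopen, intro ballI)
      fix z assume z: "z \<in> {z \<in> M. c < h y z}"
      define b where "b = (c + h y z) / 2"
      define e where "e = (h y z - b) / 2"
      have cb: "c < b" "b < h y z" "e > 0"
        using z by (auto simp: b_def e_def field_simps)
      \<comment> \<open>If some \<open>w\<close> in \<open>K z e\<close> had a value below
        \<open>b\<close>, a component \<open>K y r\<close> with \<open>r < b\<close> would contain
        \<open>w\<close>. Its union with \<open>K z e\<close> is connected and lies in the ball of
        radius \<open>r + 2 * e\<close> about \<open>y\<close>, so \<open>h y z\<close> would be at
        most \<open>r + 2 * e\<close>. This is less than \<open>b + 2 * e\<close>, which equals
        \<open>h y z\<close> by the choice of \<open>e\<close>.\<close>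
      have "w \<in> {z \<in> M. c < h y z}" if w: "w \<in> K z e" for w
      proof (rule ccontr)
        assume "w \<notin> {z \<in> M. c < h y z}"
        moreover have "w \<in> M"
          using w KM by (meson in_mball subsetD)
        ultimately have "h y w < b"
          using cb by auto
        moreover have "\<not> 1 < b"
          using cb(2) h01[of y z] by auto
        ultimately obtain r where r: "r < b" "w \<in> K y r"
          unfolding h_less by blast
        have wz: "d z w < e" "z \<in> M" "y \<in> M" "d y w < r"
          using w r KM[of z e] KM[of y r] z by auto
        have "connectedin mtopology (K y r \<union> K z e)"
          using w r Kcon by (intro connectedin_Un) auto
        moreover have "y \<in> K y r \<union> K z e"
          using wz Kpos[OF r(2)] Kmem by auto
        moreover have "K y r \<union> K z e \<subseteq> mball y (r + 2 * e)"
        proof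
          fix v assume "v \<in> K y r \<union> K z e"
          then show "v \<in> mball y (r + 2 * e)"
          proof
            assume "v \<in> K y r"
            then show ?thesis using KM[of y r] cb by auto
          next
            assume "v \<in> K z e"
            then have v: "v \<in> M" "d z v < e" using KM[of z e] by auto
            have "d y v \<le> d y w + d w z + d z v"
              using triangle[of y w v] triangle[of w z v] v wz \<open>w \<in> M\<close> by linarith
            then show ?thesis using v wz \<open>w \<in> M\<close> by (auto simp: commute)
          qed
        qed
        ultimately have "z \<in> K y (r + 2 * e)"
          using Kmax[of "K y r \<union> K z e" y "r + 2 * e"] Kmem[of z e] wz cb by blast
        then have "h y z \<le> r + 2 * e"
          unfolding h_def by (intro cInf_lower bdd) auto
        then show False
          using r by (simp add: e_def field_simps)
      qed
      moreover have "z \<in> K z e"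
        using z cb Kmem by auto
      ultimately show "\<exists>T. openin mtopology T \<and> z \<in> T \<and> T \<subseteq> {z \<in> M. c < h y z}"
        using Kop by blast
    qed
  qed
  have hbase: "\<exists>y\<in>C. \<exists>c. h y x < c \<and> {z \<in> M. h y z < c} \<subseteq> U" if U: "openin mtopology U" "x \<in> U" for U x
  proof -
    obtain r where r: "r > 0" "mball x r \<subseteq> U" "x \<in> M"
      using U by (metis openin_mtopology subsetD)
    \<comment> \<open>The centre \<open>y\<close> is taken in \<open>K x e\<close>, not just near
      \<open>x\<close>, so that \<open>K x e\<close> joins it to \<open>x\<close> inside the ball of
      radius \<open>2 * e\<close> about \<open>y\<close>. Then \<open>3 * e\<close> stays below the
      cap 1, and points within \<open>3 * e\<close> of \<open>y\<close> are within
      \<open>4 * e\<close>, at most \<open>r\<close>, of \<open>x\<close>.\<close>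
    define e where "e = min (r/4) (1/4)"
    have e: "e > 0" "4 * e \<le> r" "4 * e \<le> 1"
      using r by (auto simp: e_def)
    have "x \<in> K x e"
      using e r Kmem by auto
    then obtain y where y: "y \<in> C" "y \<in> K x e"
      using C(3) r Kop by (metis in_closure_of)
    then have dxy: "d x y < e" "y \<in> M"
      using KM[of x e] by auto
    have "K x e \<subseteq> mball y (2 * e)"
    proof
      fix v assume "v \<in> K x e"
      then have v: "v \<in> M" "d x v < e" using KM[of x e] by auto
      then show "v \<in> mball y (2 * e)"
        using triangle[of y x v] dxy r by (auto simp: commute)
    qed
    then have "x \<in> K y (2 * e)"
      using Kmax[OF Kcon y(2)] \<open>x \<in> K x e\<close> by blast
    then have "h y x < 3 * e"
      unfolding h_less using e by (intro disjI2 exI[of _ "2 * e"]) auto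
    moreover have "{z \<in> M. h y z < 3 * e} \<subseteq> U"
    proof
      fix z assume "z \<in> {z \<in> M. h y z < 3 * e}"
      then obtain s where "s < 3 * e" "z \<in> K y s"
        using h_less e by auto
      then have "z \<in> M" "d y z < 3 * e"
        using KM[of y s] by auto
      then have "z \<in> mball x r"
        using triangle[of x y z] dxy r e by auto
      then show "z \<in> U" using r by blast
    qed
    ultimately show ?thesis using y by blast
  qed
  show ?thesis
  proof (rule that[of "\<lambda>n. h (from_nat_into C n)"], unfold XM topspace_mtopology)
    have "from_nat_into C n \<in> M" for n
      using C \<open>C \<noteq> {}\<close> from_nat_into by blast
    then show "connectedin mtopology {x \<in> M. h (from_nat_into C n) x < c}" for n c
      by (rule hcon)
    show "\<exists>n c. h (from_nat_into C n) x < c \<and> {x \<in> M. h (from_nat_into C n) x < c} \<subseteq> U"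
      if U: "openin mtopology U" "x \<in> U" for U x
    proof -
      obtain y c where "y \<in> C" "h y x < c" "{z \<in> M. h y z < c} \<subseteq> U"
        using hbase[OF U] by blast
      moreover obtain n where "from_nat_into C n = y"
        using from_nat_into_surj[OF C(1) \<open>y \<in> C\<close>] by blast
      ultimately show ?thesis by blast
    qed
  qed (use hcont h01 in auto)
qed

text \<open>Only countably many levels are bad for some sublevel set \<open>{g n < q}\<close> with
  rational \<open>q\<close>. On any other level, clopen sets prevent finitely many of the
  \<open>g n\<close> from dropping by much. Since the weighted sum is constant there, no single
  \<open>g k\<close> can rise by much either, which confines a clopen set to a basic sublevel
  set.\<close>

lemma zero_dimensional_space_level_sets:
  assumes hlc: "hereditarily_locally_connected_space X"
    and sc: "second_countable X"
    and g: "\<And>n. continuous_map X euclideanreal (g n)"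
    and g01: "\<And>n x. g n x \<in> {0..1::real}"
    and gcon: "\<And>n c. connectedin X {x \<in> topspace X. g n x < c}"
    and gbase: "\<And>U x. openin X U \<Longrightarrow> x \<in> U \<Longrightarrow> \<exists>n c. g n x < c \<and> {x \<in> topspace X. g n x < c} \<subseteq> U"
    and a: "\<And>n. a n > 0" "summable a"
    and f: "continuous_map X euclideanreal f" "\<And>x. x \<in> topspace X \<Longrightarrow> (\<lambda>n. a n * g n x) sums f x"
  shows "\<exists>N. countable N \<and> (\<forall>t. t \<notin> N \<longrightarrow> zero_dimensional_space (subtopology X {x \<in> topspace X. f x = t}))"
proof -
  have lc: "locally_connected_space X"
    using hlc by (rule hereditarily_locally_connected_imp_locally_connected)
  define L where "L n q = {x \<in> topspace X. g n x < q}" for n q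
  define S where "S t e = {x \<in> topspace X. f x \<in> {t - e<..<t + e}}" for t e
  define N0 where "N0 n q = f ` {z \<in> topspace X - X closure_of L n q.
      \<forall>e>0. component_in X (S (f z) e) z \<inter> L n q \<noteq> {}}" for n q
  define N where "N = (\<Union>n. \<Union>q\<in>\<rat>. N0 n q)"
  have opS: "openin X (S t e)" for t e
    unfolding S_def by (rule openin_continuous_map_preimage[OF f(1)]) auto
  have "countable (N0 n q)" for n q
    unfolding N0_def S_def L_def
    by (rule countable_levels_with_large_components[OF hlc sc gcon f(1)])
  then have "countable N"
    unfolding N_def by (intro countable_UN countable_rat) auto
  moreover have "zero_dimensional_space (subtopology X {x \<in> topspace X. f x = t})" if t: "t \<notin> N" for t
  proof -
    define F where "F = {x \<in> topspace X. f x = t}"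
    have FX: "F \<subseteq> topspace X" by (auto simp: F_def)
    have lower: "\<exists>H. openin (subtopology X F) H \<and> closedin (subtopology X F) H \<and> z0 \<in> H \<and>
        (\<forall>z\<in>H. g n z0 - e \<le> g n z)" if z0: "z0 \<in> F" and "e > 0" for n z0 e
    proof -
      \<comment> \<open>With \<open>q\<close> strictly below \<open>g n z0\<close>, the point
        \<open>z0\<close> is off the closure of \<open>L n q\<close>. As \<open>t\<close> is not
        exceptional, the component of \<open>z0\<close> in some strip misses \<open>L n q\<close>.
        The strip contains all of \<open>F\<close>, so the trace of that component on
        \<open>F\<close> is clopen.\<close>
      obtain q where q: "q \<in> \<rat>" "g n z0 - e < q" "q < g n z0"
        using Rats_dense_in_real[of "g n z0 - e" "g n z0"] \<open>e > 0\<close> by auto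
      have "closedin X {x \<in> topspace X. g n x \<in> {..q}}"
        by (rule closedin_continuous_map_preimage[OF g]) auto
      then have "X closure_of L n q \<subseteq> {x \<in> topspace X. g n x \<in> {..q}}"
        by (intro closure_of_minimal) (auto simp: L_def)
      then have "z0 \<in> topspace X - X closure_of L n q" "f z0 = t"
        using q z0 by (auto simp: F_def)
      moreover have "t \<notin> N0 n q"
        using t q(1) by (auto simp: N_def)
      ultimately obtain e' where e': "e' > 0" "component_in X (S t e') z0 \<inter> L n q = {}"
        unfolding N0_def by blast
      define W where "W = component_in X (S t e') z0"
      have WS: "W \<subseteq> S t e'"
        unfolding W_def by (rule component_in_subset)
      have FS: "F \<subseteq> S t e'"
        using e' by (auto simp: F_def S_def)
      have "openin X W"
        unfolding W_def by (rule openin_component_in[OF lc opS])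
      then have "openin (subtopology X F) (W \<inter> F)"
        by (rule openin_subtopology_Int)
      moreover have "X closure_of W \<inter> F = W \<inter> F"
        using closure_of_component_in[OF lc opS, of t e' z0] FS closure_of_subset[OF openin_subset[OF \<open>openin X W\<close>]]
        unfolding W_def by blast
      then have "closedin (subtopology X F) (W \<inter> F)"
        by (metis closedin_closure_of closedin_subtopology)
      moreover have "z0 \<in> W \<inter> F"
        using z0 FX FS unfolding W_def by (auto simp: connected_component_of_refl)
      moreover have "g n z0 - e \<le> g n z" if "z \<in> W \<inter> F" for z
        using that e'(2) q FX unfolding W_def L_def by force
      ultimately show ?thesis by blast
    qed
    show ?thesis
      unfolding F_def[symmetric] zero_dimensional_space_def neighbourhood_base_of
    proof (intro allI impI)
      fix V0 z0 assume "openin (subtopology X F) V0 \<and> z0 \<in> V0"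
      then obtain V where V: "openin X V" "V0 = V \<inter> F" "z0 \<in> V" "z0 \<in> F"
        by (auto simp: openin_subtopology)
      obtain k c where kc: "g k z0 < c" "{x \<in> topspace X. g k x < c} \<subseteq> V"
        using gbase[OF V(1,3)] by blast
      define \<eta> where "\<eta> = a k * (c - g k z0)"
      \<comment> \<open>The amount \<eta> is the weighted rise that would take \<open>g k\<close> up
        to \<open>c\<close>. Drops of at most \<delta> in the first \<open>m\<close> functions cost
        at most \<open>\<eta> / 3\<close> in total, and \<open>m\<close> is chosen below so that the
        remaining functions cost less than \<open>\<eta> / 3\<close>, with \<open>k\<close> among
        the first \<open>m\<close>.\<close>
      define \<delta> where "\<delta> = \<eta> / (3 * (suminf a + 1))"
      have \<eta>: "\<eta> > 0" using a kc by (simp add: \<eta>_def)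
      have A: "suminf a \<ge> 0" using a by (intro suminf_nonneg) (auto intro: less_imp_le)
      have \<delta>: "\<delta> > 0" using \<eta> A by (simp add: \<delta>_def)
      have \<delta>A: "\<delta> * suminf a \<le> \<eta> / 3"
        using \<eta> A by (simp add: \<delta>_def field_simps)
      obtain m0 where m0: "\<And>n. n \<ge> m0 \<Longrightarrow> norm (\<Sum>i. a (i + n)) < \<eta> / 3"
        using suminf_exist_split[OF _ a(2), of "\<eta> / 3"] \<eta> by auto
      define m where "m = max m0 (Suc k)"
      have tail: "(\<Sum>i. a (i + m)) < \<eta> / 3"
        using m0[of m] by (auto simp: m_def)
      obtain H where H: "\<And>n. openin (subtopology X F) (H n)" "\<And>n. closedin (subtopology X F) (H n)"
          "\<And>n. z0 \<in> H n" "\<And>n z. z \<in> H n \<Longrightarrow> g n z0 - \<delta> \<le> g n z"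
        using lower[OF V(4) \<delta>] by metis
      define G where "G = (\<Inter>n<m. H n)"
      have "m > 0" by (simp add: m_def)
      then have G: "openin (subtopology X F) G" "closedin (subtopology X F) G" "z0 \<in> G"
        unfolding G_def using H by (auto intro!: openin_Inter closedin_Inter)
      have "G \<subseteq> V0"
      proof
        fix z assume z: "z \<in> G"
        have zF: "z \<in> F"
          using G(1) z openin_subset by fastforce
        \<comment> \<open>The changes \<open>b n\<close> sum to 0 on the level set. All terms other
          than \<open>b k\<close> contribute more than \<open>- 2/3 * \<eta>\<close> together, the
          tail being controlled by the values lying in \<open>{0..1}\<close>, so
          \<open>b k < \<eta>\<close>, that is, \<open>g k z < c\<close>.\<close>
        define b where "b n = a n * g n z - a n * g n z0" for n
        have "b sums (f z - f z0)"
          unfolding b_def using zF V(4) FX by (intro sums_diff f(2)) auto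
        then have b: "b sums 0"
          using zF V(4) by (simp add: F_def)
        then have sb: "summable b" "suminf b = 0"
          by (auto simp: sums_iff)
        have b_head: "b n \<ge> - (\<delta> * a n)" if "n < m" for n
        proof -
          have "g n z0 - \<delta> \<le> g n z"
            using z that H(4) by (auto simp: G_def)
          then have "a n * (g n z0 - \<delta>) \<le> a n * g n z"
            using a(1)[of n] by (intro mult_left_mono) auto
          then show ?thesis by (simp add: b_def algebra_simps)
        qed
        have b_tail: "b n \<ge> - a n" for n
        proof -
          have "a n * g n z \<ge> 0" "a n * g n z0 \<le> a n * 1"
            using a(1)[of n] g01[of n z] g01[of n z0] by (auto intro: mult_left_mono)
          then show ?thesis by (simp add: b_def)
        qed
        have "(\<Sum>i. - a (i + m)) \<le> (\<Sum>i. b (i + m))"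
          using a(2) sb b_tail by (intro suminf_le summable_minus) (auto simp: summable_iff_shift)
        then have 1: "(\<Sum>i. b (i + m)) > - (\<eta> / 3)"
          using tail a(2) by (simp add: suminf_minus summable_iff_shift)
        have k: "k < m" by (simp add: m_def)
        have "sum b {..<m} = b k + sum b ({..<m} - {k})"
          using k by (intro sum.remove) auto
        moreover have "sum b ({..<m} - {k}) \<ge> (\<Sum>n\<in>{..<m} - {k}. - (\<delta> * a n))"
          using b_head by (intro sum_mono) auto
        moreover have "(\<Sum>n\<in>{..<m} - {k}. \<delta> * a n) \<le> \<delta> * suminf a"
          unfolding sum_distrib_left[symmetric] using a \<delta>
          by (intro mult_left_mono sum_le_suminf) (auto intro: less_imp_le)
        ultimately have 2: "sum b {..<m} \<ge> b k - \<eta> / 3"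
          using \<delta>A by (simp add: sum_negf)
        have "suminf b = (\<Sum>i. b (i + m)) + sum b {..<m}"
          by (rule suminf_split_initial_segment[OF sb(1)])
        then have "b k < \<eta>"
          using 1 2 sb(2) \<eta> by linarith
        then have "a k * g k z < a k * c"
          by (simp add: b_def \<eta>_def algebra_simps)
        then have "g k z < c"
          using a(1)[of k] by simp
        then show "z \<in> V0"
          using kc(2) zF FX V(2) by blast
      qed
      with G show "\<exists>U V. openin (subtopology X F) U \<and> (openin (subtopology X F) V \<and> closedin (subtopology X F) V) \<and> z0 \<in> U \<and> U \<subseteq> V \<and> V \<subseteq> V0"
        by blast
    qed
  qed
  ultimately show ?thesis by blast
qed

text \<open>Perturbing one basic function \<open>g k\<close> by a small positive combination of all
  the \<open>g n\<close> gives a function whose level sets are zero-dimensional for all but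
  countably many values. A sublevel set of it at a good value is the required neighbourhood.\<close>

lemma hereditarily_locally_connected_zero_dimensional_frontier:
  assumes hlc: "hereditarily_locally_connected_space X"
    and X: "separable_space X" "metrizable_space X"
    and V: "openin X V" "x \<in> V"
  obtains U F where "openin X U" "x \<in> U" "U \<subseteq> V" "X frontier_of U \<subseteq> F" "zero_dimensional_space (subtopology X F)"
proof -
  have lc: "locally_connected_space X" and con: "connected_space X"
    using hlc hereditarily_locally_connected_imp_locally_connected
    by (auto simp: hereditarily_locally_connected_space_def)
  obtain g :: "nat \<Rightarrow> 'a \<Rightarrow> real" where g: "\<And>n. continuous_map X euclideanreal (g n)"
    and g01: "\<And>n x. g n x \<in> {0..1}"
    and gcon: "\<And>n c. connectedin X {x \<in> topspace X. g n x < c}"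
    and gbase: "\<And>U x. openin X U \<Longrightarrow> x \<in> U \<Longrightarrow> \<exists>n c. g n x < c \<and> {x \<in> topspace X. g n x < c} \<subseteq> U"
    by (rule connected_sublevel_functions[OF X con lc]) (rule that, blast+)
  obtain k c where kc: "g k x < c" "{x \<in> topspace X. g k x < c} \<subseteq> V"
    using gbase[OF V] by blast
  \<comment> \<open>The geometric weights add up to 2, so \<open>f x\<close> is at most
    \<open>g k x + 2 * \<epsilon>\<close>, which is below \<open>c\<close>. This leaves an
    uncountable interval of levels between \<open>f x\<close> and \<open>c\<close>.\<close>
  define \<epsilon> where "\<epsilon> = (c - g k x) / 3"
  have \<epsilon>: "\<epsilon> > 0" using kc by (simp add: \<epsilon>_def)
  define p where "p z n = (1/2) ^ n * g n z" for z n
  \<comment> \<open>These are the coefficients of \<open>f\<close> as one series: the extra 1 at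
    \<open>k\<close> accounts for the summand \<open>g k z\<close>, and the \<epsilon>-part makes
    every coefficient positive.\<close>
  define a where "a n = (if n = k then 1 else 0) + \<epsilon> * (1/2) ^ n" for n
  define f where "f z = g k z + \<epsilon> * suminf (p z)" for z
  have p_bounds: "0 \<le> p z n" "p z n \<le> (1/2) ^ n" for z n
    using g01[of n z] by (auto simp: p_def intro: mult_left_le)
  have sp: "summable (p z)" for z
    by (rule summable_comparison_test'[of "\<lambda>n. (1/2)^n" 0])
       (use p_bounds in \<open>auto simp: summable_geometric_iff\<close>)
  have p0: "0 \<le> suminf (p z)" for z
    using p_bounds sp by (intro suminf_nonneg) auto
  have p2: "suminf (p z) \<le> 2" for z
  proof -
    have "suminf (p z) \<le> (\<Sum>n. (1/2) ^ n)"
      using p_bounds sp by (intro suminf_le) (auto simp: summable_geometric_iff)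
    then show ?thesis by (simp add: suminf_geometric)
  qed
  have "continuous_map X euclideanreal (\<lambda>z. suminf (p z))"
  proof -
    have "continuous_map X Met_TC.mtopology (\<lambda>z. suminf (p z))"
    proof (rule Met_TC.continuous_map_uniform_limit[where F=sequentially and f="\<lambda>n z. \<Sum>i<n. p z i"])
      show "\<forall>\<^sub>F n in sequentially. continuous_map X Met_TC.mtopology (\<lambda>z. \<Sum>i<n. p z i)"
        unfolding p_def using g
        by (intro always_eventually allI) (auto intro!: continuous_map_sum continuous_map_real_mult_left)
      fix e :: real assume "e > 0"
      have "uniform_limit UNIV (\<lambda>n z. \<Sum>i<n. p z i) (\<lambda>z. suminf (p z)) sequentially"
        by (rule Weierstrass_m_test[where M="\<lambda>n. (1/2)^n"])
           (use p_bounds in \<open>auto simp: summable_geometric_iff\<close>)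
      then have "\<forall>\<^sub>F n in sequentially. \<forall>z\<in>UNIV. dist (\<Sum>i<n. p z i) (suminf (p z)) < e"
        using \<open>e > 0\<close> unfolding uniform_limit_iff by blast
      then show "\<forall>\<^sub>F n in sequentially. \<forall>z\<in>topspace X. suminf (p z) \<in> UNIV \<and> dist (\<Sum>i<n. p z i) (suminf (p z)) < e"
        by (rule eventually_mono) auto
    qed simp
    then show ?thesis by simp
  qed
  then have f: "continuous_map X euclideanreal f"
    unfolding f_def using g by (intro continuous_map_add continuous_map_real_mult_left)
  have a: "a n > 0" for n
    using \<epsilon> by (auto simp: a_def intro: add_nonneg_pos)
  have single: "(\<lambda>n. if n = k then h n else 0) sums h k" for h :: "nat \<Rightarrow> real"
    by (rule sums_single)
  have sa: "summable a"
    unfolding a_def using single[of "\<lambda>_. 1"]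
    by (intro summable_add summable_mult) (auto simp: sums_iff summable_geometric_iff)
  have fs: "(\<lambda>n. a n * g n z) sums f z" for z
  proof -
    have "(\<lambda>n. (if n = k then g n z else 0) + \<epsilon> * p z n) sums (g k z + \<epsilon> * suminf (p z))"
      using sp by (intro sums_add single sums_mult summable_sums)
    moreover have "(\<lambda>n. a n * g n z) = (\<lambda>n. (if n = k then g n z else 0) + \<epsilon> * p z n)"
      by (auto simp: a_def p_def algebra_simps)
    ultimately show ?thesis by (simp add: f_def)
  qed
  have "\<exists>N. countable N \<and> (\<forall>t. t \<notin> N \<longrightarrow> zero_dimensional_space (subtopology X {x \<in> topspace X. f x = t}))"
    by (rule zero_dimensional_space_level_sets[OF hlc second_countable_metrizable_separable[OF X] g g01 gcon _ a sa f fs])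
       (erule (1) gbase)
  then obtain N where N: "countable N" "\<And>t. t \<notin> N \<Longrightarrow> zero_dimensional_space (subtopology X {x \<in> topspace X. f x = t})"
    by blast
  have "f x < c"
    using p2[of x] \<epsilon> mult_left_mono[OF p2[of x], of \<epsilon>] kc(1) by (simp add: f_def \<epsilon>_def)
  then have "\<not> {f x<..<c} \<subseteq> N"
    using N(1) uncountable_open_interval[of "f x" c] countable_subset by blast
  then obtain t where "t \<in> {f x<..<c}" "t \<notin> N"
    by blast
  then have t: "f x < t" "t < c" "t \<notin> N"
    by simp_all
  define U where "U = {z \<in> topspace X. f z \<in> {..<t}}"
  have U: "openin X U"
    unfolding U_def by (rule openin_continuous_map_preimage[OF f]) auto
  have clU: "X closure_of U \<subseteq> {z \<in> topspace X. f z \<in> {..t}}"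
  proof (rule closure_of_minimal)
    show "closedin X {z \<in> topspace X. f z \<in> {..t}}"
      by (rule closedin_continuous_map_preimage[OF f]) auto
  qed (auto simp: U_def)
  show thesis
  proof (rule that)
    show "X frontier_of U \<subseteq> {z \<in> topspace X. f z = t}"
      using clU interior_of_openin[OF U] by (fastforce simp: frontier_of_def U_def)
    show "x \<in> U"
      using V openin_subset t by (fastforce simp: U_def)
    have g_le: "g k z \<le> f z" for z
      using p0[of z] \<epsilon> by (simp add: f_def)
    have "U \<subseteq> {x \<in> topspace X. g k x < c}"
    proof
      fix z assume "z \<in> U"
      then show "z \<in> {x \<in> topspace X. g k x < c}"
        using t(2) g_le[of z] by (simp add: U_def)
    qed
    then show "U \<subseteq> V"
      using kc(2) by (rule subset_trans)
  qed (use U N t in auto)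
qed

subsection \<open>R-trees\<close>

lemma arc_betweenE:
  assumes "arc_between X A x y"
  obtains g where "continuous_map (top_of_set {0..1::real}) X g" "inj_on g {0..1}"
    "g ` {0..1} = A" "g 0 = x" "g 1 = y"
  using assms unfolding arc_between_def embedding_map_def
  by (metis continuous_map_in_subtopology homeomorphic_imp_continuous_map homeomorphic_imp_injective_map topspace_euclidean_subtopology)

lemma arc_betweenI:
  assumes "Hausdorff_space X" "continuous_map (top_of_set {0..1::real}) X g" "inj_on g {0..1}"
    "g ` {0..1} = A" "g 0 = x" "g 1 = y"
  shows "arc_between X A x y"
proof -
  have "embedding_map (top_of_set {0..1}) X g"
    using assms by (intro continuous_imp_embedding_map) (auto simp: compact_space_subtopology)
  then show ?thesis
    using assms unfolding arc_between_def by blast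
qed

lemma arc_between_props:
  assumes "arc_between X A x y"
  shows "connectedin X A" "compactin X A" "x \<in> A" "y \<in> A" "A \<subseteq> topspace X"
proof -
  obtain g where g: "continuous_map (top_of_set {0..1::real}) X g" "g ` {0..1} = A" "g 0 = x" "g 1 = y"
    using assms by (rule arc_betweenE)
  show "connectedin X A"
    using connectedin_continuous_map_image[OF g(1), of "{0..1}"] g(2) by (simp add: connectedin_subtopology)
  show "compactin X A"
    using image_compactin[OF _ g(1), of "{0..1}"] g(2) by (simp add: compactin_subtopology)
  then show "A \<subseteq> topspace X"
    by (rule compactin_subset_topspace)
  show "x \<in> A" "y \<in> A"
    using g by force+
qed

text \<open>The first point of the first arc that lies on the second one is where the two are joined.\<close>

lemma arc_between_trans:
  assumes X: "Hausdorff_space X" and A: "arc_between X A x y" and B: "arc_between X B y z" and "x \<noteq> z"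
  obtains C where "C \<subseteq> A \<union> B" "arc_between X C x z"
proof -
  obtain g where g: "continuous_map (top_of_set {0..1::real}) X g" "inj_on g {0..1}"
      "g ` {0..1} = A" "g 0 = x" "g 1 = y"
    using A by (rule arc_betweenE)
  obtain h where h: "continuous_map (top_of_set {0..1::real}) X h" "inj_on h {0..1}"
      "h ` {0..1} = B" "h 0 = y" "h 1 = z"
    using B by (rule arc_betweenE)
  have "closedin X B"
    using arc_between_props(2)[OF B] X by (rule compactin_imp_closedin[rotated])
  define T where "T = {t \<in> {0..1}. g t \<in> B}"
  have "closedin (top_of_set {0..1}) T"
    using closedin_continuous_map_preimage[OF g(1) \<open>closedin X B\<close>] by (simp add: T_def)
  then have "compact T"
    by (rule closedin_compact[OF compact_Icc])
  moreover have "1 \<in> T"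
    using g h arc_between_props[OF B] by (simp add: T_def)
  ultimately obtain s where s: "s \<in> T" and smin: "\<And>t. t \<in> T \<Longrightarrow> s \<le> t"
    using compact_attains_inf[of T] by auto
  obtain r where r: "r \<in> {0..1}" "h r = g s"
    using s h(3) unfolding T_def by (metis (mono_tags, lifting) imageE mem_Collect_eq)
  have s01: "0 \<le> s" "s \<le> 1"
    using s by (auto simp: T_def)
  \<comment> \<open>This is the total parameter length of the initial piece of \<open>g\<close> up
    to \<open>s\<close> and the final piece of \<open>h\<close> from \<open>r\<close>;
    \<open>k\<close> runs through both at speed \<open>l\<close>. It vanishes only if
    \<open>x\<close> and \<open>z\<close> coincide.\<close>
  define l where "l = s + (1 - r)"
  have "l \<noteq> 0"
  proof
    assume "l = 0"
    then have "s = 0" "r = 1"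
      using s01 r by (auto simp: l_def)
    then show False
      using r g h \<open>x \<noteq> z\<close> by simp
  qed
  then have l: "l > 0"
    using s01 r by (auto simp: l_def)
  define k where "k t = (if l * t \<le> s then g (l * t) else h (r + (l * t - s)))" for t
  have lt: "0 \<le> l * t" "l * t \<le> l" if "t \<in> {0..1}" for t
    using that l by (auto intro: mult_left_le)
  have k_mem: "k t \<in> A \<union> B" if "t \<in> {0..1}" for t
  proof -
    have "l * t \<in> {0..1}" if "l * t \<le> s"
      using that s01 lt[OF \<open>t \<in> {0..1}\<close>] by auto
    moreover have "r + (l * t - s) \<in> {0..1}" if "\<not> l * t \<le> s"
      using that r lt[OF \<open>t \<in> {0..1}\<close>] by (auto simp: l_def)
    ultimately show ?thesis
      unfolding k_def using g(3) h(3) by auto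
  qed
  \<comment> \<open>A value of the \<open>g\<close>-piece on \<open>B\<close> has its parameter in
    \<open>T\<close>, so by minimality of \<open>s\<close> it is the junction point. The
    \<open>h\<close>-piece strictly after \<open>r\<close> does not return there.\<close>
  have key: False if t: "t1 \<in> {0..1}" "t2 \<in> {0..1}" "l * t1 \<le> s" "\<not> l * t2 \<le> s"
      and eq: "g (l * t1) = h (r + (l * t2 - s))" for t1 t2
  proof -
    have m: "l * t1 \<in> {0..1}" "r + (l * t2 - s) \<in> {0..1}"
      using t s01 r lt[of t1] lt[of t2] by (auto simp: l_def)
    then have "l * t1 \<in> T"
      using eq h(3) by (auto simp: T_def)
    then have "l * t1 = s"
      using smin t by force
    then have "h r = h (r + (l * t2 - s))"
      using eq r by simp
    then have "r = r + (l * t2 - s)"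
      using h(2) r m by (meson inj_onD)
    then show False using t by simp
  qed
  have inj: "inj_on k {0..1}"
  proof (rule inj_onI)
    fix t1 t2 assume t: "t1 \<in> {0..1}" "t2 \<in> {0..1}" and eq: "k t1 = k t2"
    have "l * t1 = l * t2"
    proof (cases "l * t1 \<le> s"; cases "l * t2 \<le> s")
      assume c: "l * t1 \<le> s" "l * t2 \<le> s"
      then have "g (l * t1) = g (l * t2)" "l * t1 \<in> {0..1}" "l * t2 \<in> {0..1}"
        using eq lt[OF t(1)] lt[OF t(2)] s01 by (auto simp: k_def)
      then show ?thesis using g(2) by (meson inj_onD)
    next
      assume c: "\<not> l * t1 \<le> s" "\<not> l * t2 \<le> s"
      then have "h (r + (l * t1 - s)) = h (r + (l * t2 - s))"
          "r + (l * t1 - s) \<in> {0..1}" "r + (l * t2 - s) \<in> {0..1}"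
        using eq lt[OF t(1)] lt[OF t(2)] r by (auto simp: k_def l_def)
      then have "r + (l * t1 - s) = r + (l * t2 - s)"
        using h(2) by (meson inj_onD)
      then show ?thesis by simp
    next
      assume c: "l * t1 \<le> s" "\<not> l * t2 \<le> s"
      then show ?thesis using key[OF t c] eq by (simp add: k_def)
    next
      assume c: "\<not> l * t1 \<le> s" "l * t2 \<le> s"
      then show ?thesis using key[OF t(2,1) c(2,1)] eq by (simp add: k_def)
    qed
    then show "t1 = t2" using l by simp
  qed
  have cont: "continuous_map (top_of_set {0..1}) X k"
    unfolding k_def
  proof (rule continuous_map_cases_le)
    show "continuous_map (top_of_set {0..1}) euclideanreal (\<lambda>t. l * t)"
      by (auto intro!: continuous_intros)
    show "continuous_map (top_of_set {0..1}) euclideanreal (\<lambda>t. s)"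
      by simp
    let ?S = "subtopology (top_of_set {0..1}) {x \<in> topspace (top_of_set {0..1}). l * x \<le> s}"
    let ?R = "subtopology (top_of_set {0..1}) {x \<in> topspace (top_of_set {0..1}). s \<le> l * x}"
    have "continuous_map ?S (top_of_set {0..1}) (\<lambda>t. l * t)"
      using s01 lt by (auto simp: continuous_map_in_subtopology subtopology_subtopology intro!: continuous_intros)
    then show "continuous_map ?S X (\<lambda>t. g (l * t))"
      using continuous_map_compose[OF _ g(1)] by (simp add: o_def)
    have "r + (l * t - s) \<in> {0..1}" if "t \<in> {0..1}" "s \<le> l * t" for t
      using that r lt[OF that(1)] by (auto simp: l_def)
    then have "continuous_map ?R (top_of_set {0..1}) (\<lambda>t. r + (l * t - s))"
      by (auto simp: continuous_map_in_subtopology subtopology_subtopology intro!: continuous_intros)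
    then show "continuous_map ?R X (\<lambda>t. h (r + (l * t - s)))"
      using continuous_map_compose[OF _ h(1)] by (simp add: o_def)
    show "g (l * t) = h (r + (l * t - s))" if "l * t = s" for t
      using that r by simp
  qed
  have k0: "k 0 = x"
    using s01 g by (simp add: k_def)
  have k1: "k 1 = z"
    using r h s01 by (cases "r = 1") (auto simp: k_def l_def)
  have "arc_between X (k ` {0..1}) x z"
    by (rule arc_betweenI[OF X cont inj refl k0 k1])
  then show thesis
    using k_mem by (intro that[of "k ` {0..1}"] image_subsetI)
qed

text \<open>If \<open>C\<close> missed a point \<open>c\<close> of the arc, the points other than
  \<open>c\<close> that can be reached from \<open>x\<close> by arcs avoiding \<open>c\<close> would
  form a set open and closed in the complement of \<open>c\<close>, by local arcwise connectedness
  and joining of arcs. By uniqueness of arcs \<open>y\<close> is not among them, so \<open>C\<close>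
  would be disconnected.\<close>

lemma R_tree_connectedin_contains_arc:
  assumes X: "Hausdorff_space X" and tree: "R_tree X"
    and C: "connectedin X C" "x \<in> C" "y \<in> C" and A: "arc_between X A x y" and "x \<noteq> y"
  shows "A \<subseteq> C"
proof
  fix c assume "c \<in> A"
  show "c \<in> C"
  proof (rule ccontr)
    assume "c \<notin> C"
    have CX: "C \<subseteq> topspace X"
      using C(1) by (rule connectedin_subset_topspace)
    \<comment> \<open>The case \<open>u = x\<close> is separate because an arc has distinct
      endpoints.\<close>
    define P where "P u \<longleftrightarrow> u = x \<or> (\<exists>B. arc_between X B x u \<and> c \<notin> B)" for u
    have step: "P v" if Pu: "P u" and D: "arc_between X D u v" "c \<notin> D" for u v D
    proof (cases "v = x \<or> u = x")
      case True
      then show ?thesis using Pu D by (auto simp: P_def)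
    next
      case False
      then obtain B where B: "arc_between X B x u" "c \<notin> B"
        using \<open>P u\<close> by (auto simp: P_def)
      obtain E where "E \<subseteq> B \<union> D" "arc_between X E x v"
        using arc_between_trans[OF X B(1) D(1)] False by metis
      then show ?thesis
        using B D(2) by (auto simp: P_def)
    qed
    have op: "openin X (topspace X - {c})"
      using X \<open>c \<in> A\<close> arc_between_props(5)[OF A]
      by (intro openin_diff openin_topspace closedin_Hausdorff_singleton) auto
    have local: "\<exists>U. openin X U \<and> u \<in> U \<and> (\<forall>v\<in>U. v \<in> topspace X - {c} \<and> (P v \<longleftrightarrow> P u))"
      if u: "u \<in> topspace X - {c}" for u
    proof -
      have "neighbourhood_base_of (arcwise_connectedin X) X"
        using tree by (simp add: R_tree_def locally_arcwise_connected_space_def)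
      then obtain U V where U: "openin X U" "arcwise_connectedin X V" "u \<in> U" "U \<subseteq> V" "V \<subseteq> topspace X - {c}"
        using op u unfolding neighbourhood_base_of by meson
      have "P v \<longleftrightarrow> P u" if "v \<in> U" for v
      proof (cases "v = u")
        case False
        then obtain D D' where "D \<subseteq> V" "arc_between X D u v" "D' \<subseteq> V" "arc_between X D' v u"
          using U \<open>v \<in> U\<close> unfolding arcwise_connectedin_def by (metis subsetD)
        then show ?thesis
          using step[of u D v] step[of v D' u] U(5) by blast
      qed simp
      then show ?thesis
        using U by blast
    qed
    define P1 where "P1 = {u \<in> topspace X - {c}. P u}"
    define P2 where "P2 = {u \<in> topspace X - {c}. \<not> P u}"
    have "\<exists>T. openin X T \<and> u \<in> T \<and> T \<subseteq> P1" if "u \<in> P1" for u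
      using local[of u] that unfolding P1_def by blast
    then have "openin X P1"
      using openin_subopen by blast
    moreover have "\<exists>T. openin X T \<and> u \<in> T \<and> T \<subseteq> P2" if "u \<in> P2" for u
      using local[of u] that unfolding P2_def by blast
    then have "openin X P2"
      using openin_subopen by blast
    moreover have "C \<subseteq> P1 \<union> P2"
      using CX \<open>c \<notin> C\<close> by (auto simp: P1_def P2_def)
    moreover have "x \<in> P1 \<inter> C"
      using C CX \<open>c \<notin> C\<close> by (auto simp: P1_def P_def)
    moreover have "y \<in> P2 \<inter> C"
    proof -
      have "\<not> P y"
      proof
        assume "P y"
        then obtain B where "arc_between X B x y" "c \<notin> B"
          using \<open>x \<noteq> y\<close> by (auto simp: P_def)
        moreover have "\<exists>!A. arc_between X A x y"
          using tree C CX \<open>x \<noteq> y\<close> unfolding R_tree_def uniquely_arcwise_connected_space_def by blast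
        ultimately show False
          using A \<open>c \<in> A\<close> by blast
      qed
      then show ?thesis
        using C CX \<open>c \<notin> C\<close> by (auto simp: P2_def)
    qed
    moreover have "P1 \<inter> P2 \<inter> C = {}"
      by (auto simp: P1_def P2_def)
    ultimately show False
      using connectedinD[OF C(1), of P1 P2] by blast
  qed
qed

text \<open>Two points of \<open>V \<inter> C\<close>, with \<open>V\<close> arcwise connected, are
  joined by an arc in \<open>V\<close>, and the connected set \<open>C\<close> contains that arc as
  well. So small arcwise connected neighbourhoods have connected traces on \<open>C\<close>.\<close>

lemma R_tree_imp_hereditarily_locally_connected_space:
  assumes X: "Hausdorff_space X" and tree: "R_tree X"
  shows "hereditarily_locally_connected_space X"
  unfolding hereditarily_locally_connected_space_def
proof (intro conjI allI impI)
  show "connected_space X"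
    unfolding connected_space_subconnected
  proof (intro ballI)
    fix x y assume xy: "x \<in> topspace X" "y \<in> topspace X"
    show "\<exists>S. connectedin X S \<and> x \<in> S \<and> y \<in> S"
    proof (cases "x = y")
      case True
      then show ?thesis using xy by (intro exI[of _ "{x}"]) auto
    next
      case False
      then obtain A where "arc_between X A x y"
        using tree xy unfolding R_tree_def uniquely_arcwise_connected_space_def by blast
      then show ?thesis
        using arc_between_props[of X A x y] by blast
    qed
  qed
next
  fix C assume C: "connectedin X C"
  show "locally_connected_space (subtopology X C)"
    unfolding locally_connected_space_def neighbourhood_base_of
  proof (intro allI impI)
    fix W x assume "openin (subtopology X C) W \<and> x \<in> W"
    then obtain T where T: "openin X T" "W = T \<inter> C" "x \<in> T" "x \<in> C"
      by (auto simp: openin_subtopology)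
    have "neighbourhood_base_of (arcwise_connectedin X) X"
      using tree by (simp add: R_tree_def locally_arcwise_connected_space_def)
    then obtain U V where U: "openin X U" "arcwise_connectedin X V" "x \<in> U" "U \<subseteq> V" "V \<subseteq> T"
      using T unfolding neighbourhood_base_of by meson
    have VX: "V \<subseteq> topspace X"
      using U by (simp add: arcwise_connectedin_def)
    have "connected_space (subtopology X (V \<inter> C))"
      unfolding connected_space_subconnected connectedin_subtopology
    proof (intro ballI)
      fix a b assume "a \<in> topspace (subtopology X (V \<inter> C))" "b \<in> topspace (subtopology X (V \<inter> C))"
      then have ab: "a \<in> V \<inter> C" "b \<in> V \<inter> C" by auto
      show "\<exists>S. (connectedin X S \<and> S \<subseteq> V \<inter> C) \<and> a \<in> S \<and> b \<in> S"
      proof (cases "a = b")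
        case True
        then show ?thesis using ab VX by (intro exI[of _ "{a}"]) auto
      next
        case False
        then obtain A where A: "A \<subseteq> V" "arc_between X A a b"
          using U(2) ab unfolding arcwise_connectedin_def by blast
        moreover have "A \<subseteq> C"
          using R_tree_connectedin_contains_arc[OF X tree C _ _ A(2) False] ab by blast
        ultimately show ?thesis
          using arc_between_props[OF A(2)] by blast
      qed
    qed
    then have "connectedin X (V \<inter> C)"
      using VX by (auto simp: connectedin_def)
    then have "connectedin (subtopology X C) (V \<inter> C)"
      by (simp add: connectedin_subtopology)
    moreover have "openin (subtopology X C) (U \<inter> C)"
      using U by (simp add: openin_subtopology_Int)
    ultimately show "\<exists>U V. openin (subtopology X C) U \<and> connectedin (subtopology X C) V \<and> x \<in> U \<and> U \<subseteq> V \<and> V \<subseteq> W"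
      using U(3-5) T(2,4) by (intro exI[of _ "U \<inter> C"] exI[of _ "V \<inter> C"] conjI) auto
  qed
qed

subsection \<open>Dimension of subspaces\<close>

lemma zero_dimensional_space_subtopology:
  assumes "zero_dimensional_space (subtopology X T)" "S \<subseteq> T"
  shows "zero_dimensional_space (subtopology X S)"
  unfolding zero_dimensional_space_def neighbourhood_base_of
proof (intro allI impI)
  fix W x assume "openin (subtopology X S) W \<and> x \<in> W"
  then obtain O' where O: "openin X O'" "W = O' \<inter> S" "x \<in> O'" "x \<in> S"
    by (auto simp: openin_subtopology)
  then have "openin (subtopology X T) (O' \<inter> T)" "x \<in> O' \<inter> T"
    using \<open>S \<subseteq> T\<close> by (auto simp: openin_subtopology_Int)
  then obtain U V where UV: "openin (subtopology X T) U" "openin (subtopology X T) V" "closedin (subtopology X T) V"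
      "x \<in> U" "U \<subseteq> V" "V \<subseteq> O' \<inter> T"
    using assms(1) unfolding zero_dimensional_space_def neighbourhood_base_of by meson
  have ST: "subtopology X S = subtopology (subtopology X T) S"
    using \<open>S \<subseteq> T\<close> by (simp add: subtopology_subtopology Int_absorb1)
  have "openin (subtopology X S) (V \<inter> S)" "closedin (subtopology X S) (V \<inter> S)"
    unfolding ST using UV by (auto simp: openin_subtopology_Int closedin_subtopology)
  moreover have "x \<in> V \<inter> S" "V \<inter> S \<subseteq> W"
    using UV O by auto
  ultimately show "\<exists>U V. openin (subtopology X S) U \<and> (openin (subtopology X S) V \<and> closedin (subtopology X S) V) \<and>
      x \<in> U \<and> U \<subseteq> V \<and> V \<subseteq> W"
    by blast
qed

lemma frontier_of_subtopology_Int_subset: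
  "(subtopology X Y) frontier_of (U \<inter> Y) \<subseteq> X frontier_of U \<inter> Y" if "openin X U"
proof -
  have "(subtopology X Y) interior_of (U \<inter> Y) = U \<inter> Y"
    using that by (simp add: interior_of_openin openin_subtopology_Int)
  moreover have "(subtopology X Y) closure_of (U \<inter> Y) \<subseteq> Y \<inter> X closure_of U"
    using closure_of_mono[of "Y \<inter> (U \<inter> Y)" U X] by (auto simp: closure_of_subtopology)
  ultimately show ?thesis
    using that by (auto simp: frontier_of_def interior_of_openin)
qed

lemma top_dim_eq_0_iff: "top_dim X = 0 \<longleftrightarrow> zero_dimensional_space X"
proof
  assume "zero_dimensional_space X"
  then have "enat 0 \<in> {enat n |n. dimension_le n X}"
    by force
  then have "top_dim X \<le> enat 0"
    unfolding top_dim_def by (rule Inf_lower)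
  then show "top_dim X = 0"
    by (simp add: zero_enat_def[symmetric])
next
  assume 0: "top_dim X = 0"
  show "zero_dimensional_space X"
  proof (rule ccontr)
    assume "\<not> zero_dimensional_space X"
    then have "1 \<le> e" if "e \<in> {enat n |n. dimension_le n X}" for e
    proof -
      from that obtain n where "e = enat n" "dimension_le n X"
        by blast
      then show ?thesis
        using \<open>\<not> zero_dimensional_space X\<close> by (cases n) (auto simp: one_enat_def)
    qed
    then have "1 \<le> top_dim X"
      unfolding top_dim_def by (rule Inf_greatest)
    then show False
      using 0 by simp
  qed
qed

lemma top_dim_le_1:
  assumes "dimension_le 1 X"
  shows "top_dim X \<le> 1"
proof -
  have "enat 1 \<in> {enat n |n. dimension_le n X}"
    using assms by blast
  then have "top_dim X \<le> enat 1"
    unfolding top_dim_def by (rule Inf_lower)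
  then show ?thesis
    by (simp add: one_enat_def)
qed

text \<open>Neighbourhoods with zero-dimensional boundary are taken in \<open>X\<close> and traced
  on \<open>Y\<close>, where the boundary can only shrink. This one base yields both the dimension
  bound for \<open>Y\<close> and the boundary clause of \<open>one_dimensional_at\<close>.\<close>

lemma hereditarily_locally_connected_subspace_base:
  assumes hlc: "hereditarily_locally_connected_space X"
    and X: "separable_space X" "metrizable_space X"
  shows "neighbourhood_base_of (\<lambda>V. openin (subtopology X Y) V \<and>
    zero_dimensional_space (subtopology (subtopology X Y) (subtopology X Y frontier_of V))) (subtopology X Y)"
  unfolding neighbourhood_base_of
proof (intro allI impI)
  fix W x assume "openin (subtopology X Y) W \<and> x \<in> W"
  then obtain V where V: "openin X V" "W = V \<inter> Y" "x \<in> V" "x \<in> Y"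
    by (auto simp: openin_subtopology)
  obtain U F where U: "openin X U" "x \<in> U" "U \<subseteq> V" "X frontier_of U \<subseteq> F" "zero_dimensional_space (subtopology X F)"
    by (rule hereditarily_locally_connected_zero_dimensional_frontier[OF hlc X V(1,3)])
  have "subtopology X Y frontier_of (U \<inter> Y) \<subseteq> X frontier_of U \<inter> Y"
    using U(1) by (rule frontier_of_subtopology_Int_subset)
  then have "Y \<inter> subtopology X Y frontier_of (U \<inter> Y) \<subseteq> F"
    using U(4) by blast
  then have "zero_dimensional_space (subtopology (subtopology X Y) (subtopology X Y frontier_of (U \<inter> Y)))"
    unfolding subtopology_subtopology by (rule zero_dimensional_space_subtopology[OF U(5)])
  moreover have "openin (subtopology X Y) (U \<inter> Y)"
    using U(1) by (rule openin_subtopology_Int)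
  moreover have "x \<in> U \<inter> Y" "U \<inter> Y \<subseteq> W"
    using U V by auto
  ultimately show "\<exists>U V. openin (subtopology X Y) U \<and> (openin (subtopology X Y) V \<and>
      zero_dimensional_space (subtopology (subtopology X Y) (subtopology X Y frontier_of V))) \<and> x \<in> U \<and> U \<subseteq> V \<and> V \<subseteq> W"
    by blast
qed

lemma hereditarily_locally_connected_top_dim_le_1:
  assumes "hereditarily_locally_connected_space X" "separable_space X" "metrizable_space X"
  shows "top_dim (subtopology X Y) \<le> 1"
proof (rule top_dim_le_1)
  show "dimension_le 1 (subtopology X Y)"
    using hereditarily_locally_connected_subspace_base[OF assms] by (simp add: One_nat_def)
qed

text \<open>The boundary clause of \<open>one_dimensional_at\<close> holds at every point of
  \<open>Y\<close> by the preceding base, so only failure of zero-dimensionality is left.\<close>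

lemma hereditarily_locally_connected_Lambda_set_eq:
  assumes "hereditarily_locally_connected_space X" "separable_space X" "metrizable_space X" "Y \<subseteq> topspace X"
  shows "Lambda_set (subtopology X Y) = {y \<in> Y. \<not> zero_dimensional_at (subtopology X Y) y}"
proof -
  have "(\<lambda>V. openin (subtopology X Y) V \<and> top_dim (subtopology (subtopology X Y) (subtopology X Y frontier_of V)) \<le> 0)
      = (\<lambda>V. openin (subtopology X Y) V \<and> zero_dimensional_space (subtopology (subtopology X Y) (subtopology X Y frontier_of V)))"
    by (simp add: top_dim_eq_0_iff)
  then show ?thesis
    using hereditarily_locally_connected_subspace_base[OF assms(1-3), of Y] assms(4)
    unfolding Lambda_set_def one_dimensional_at_def neighbourhood_base_of_def
    by (auto simp: topspace_subtopology_subset)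
qed

text \<open>Both dimensions are at most 1, so it is enough that one is 0 exactly when the other is.
  If \<open>L\<close> is zero-dimensional, then \<open>Y\<close> is zero-dimensional at the points
  of \<open>L\<close> too, and elsewhere it is so by the description of \<open>L\<close>.\<close>

lemma hereditarily_locally_connected_top_dim_Lambda_set:
  assumes hlc: "hereditarily_locally_connected_space X"
    and X: "separable_space X" "metrizable_space X" and YX: "Y \<subseteq> topspace X"
  shows "top_dim (subtopology X (Lambda_set (subtopology X Y))) = top_dim (subtopology X Y)"
proof -
  define L where "L = Lambda_set (subtopology X Y)"
  have L: "L = {y \<in> Y. \<not> zero_dimensional_at (subtopology X Y) y}"
    unfolding L_def by (rule hereditarily_locally_connected_Lambda_set_eq[OF hlc X YX])
  have LX: "L \<subseteq> topspace X"
    using L YX by auto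
  have "zero_dimensional_space (subtopology X Y)" if "zero_dimensional_space (subtopology X L)"
  proof -
    have "zero_dimensional_at (subtopology X Y) y" if y: "y \<in> Y" for y
    proof (cases "y \<in> L")
      case True
      have "y \<in> topspace (subtopology X L)"
        using True LX by auto
      then have "zero_dimensional_at (subtopology X L) y"
        using \<open>zero_dimensional_space (subtopology X L)\<close>
        unfolding zero_dimensional_space_def zero_dimensional_at_def neighbourhood_base_of_def by blast
      then show ?thesis
        using L by (intro zero_dimensional_at_of_zero_dimensional_subset[OF hlc X YX _ _ True]) auto
    qed (use L y in auto)
    then show ?thesis
      by (auto simp: zero_dimensional_space_def zero_dimensional_at_def neighbourhood_base_of_def)
  qed
  moreover have "zero_dimensional_space (subtopology X L)" if "zero_dimensional_space (subtopology X Y)"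
    using zero_dimensional_space_subtopology[OF that] L by auto
  ultimately have "top_dim (subtopology X L) = 0 \<longleftrightarrow> top_dim (subtopology X Y) = 0"
    unfolding top_dim_eq_0_iff by blast
  moreover have "e = 0 \<or> e = 1" if "e \<le> 1" for e :: enat
    using that by (metis ileI1 not_less one_eSuc order_antisym zero_le)
  ultimately show ?thesis
    using hereditarily_locally_connected_top_dim_le_1[OF hlc X] unfolding L_def[symmetric]
    by metis
qed

theorem corollary2:
  fixes X :: "'a topology"
  assumes "separable_space X" and "metrizable_space X"
  shows "(hereditarily_locally_connected_space X \<longrightarrow>
      (\<forall>Y. Y \<subseteq> topspace X \<longrightarrow>
         top_dim (subtopology X (Lambda_set (subtopology X Y))) = top_dim (subtopology X Y)) \<and>
      (\<forall>Y. Y \<subseteq> topspace X \<longrightarrow> \<not> weakly_one_dimensional (subtopology X Y))) \<and>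
    (R_tree X \<longrightarrow>
      hereditarily_locally_connected_space X \<and>
      (\<forall>Y. Y \<subseteq> topspace X \<longrightarrow>
         top_dim (subtopology X (Lambda_set (subtopology X Y))) = top_dim (subtopology X Y)) \<and>
      (\<forall>Y. Y \<subseteq> topspace X \<longrightarrow> \<not> weakly_one_dimensional (subtopology X Y)))"
proof -
  have eq: "top_dim (subtopology X (Lambda_set (subtopology X Y))) = top_dim (subtopology X Y)"
    if "hereditarily_locally_connected_space X" "Y \<subseteq> topspace X" for Y
    using that assms by (intro hereditarily_locally_connected_top_dim_Lambda_set)
  have "\<not> weakly_one_dimensional (subtopology X Y)"
    if "hereditarily_locally_connected_space X" "Y \<subseteq> topspace X" for Y
  proof -
    \<comment> \<open>\<open>weakly_one_dimensional\<close> forms this subspace inside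
      \<open>Y\<close>, while \<open>eq\<close> forms it inside \<open>X\<close>. Once they are
      identified, the dimensions 1 and 0 would have to agree.\<close>
    have "Lambda_set (subtopology X Y) \<subseteq> Y"
      by (auto simp: Lambda_set_def)
    then have "subtopology (subtopology X Y) (Lambda_set (subtopology X Y)) = subtopology X (Lambda_set (subtopology X Y))"
      by (simp add: subtopology_subtopology Int_absorb1)
    then show ?thesis
      using eq[OF that] by (simp add: weakly_one_dimensional_def)
  qed
  moreover have "hereditarily_locally_connected_space X" if "R_tree X"
    using assms(2) that by (intro R_tree_imp_hereditarily_locally_connected_space metrizable_imp_Hausdorff_space)
  ultimately show ?thesis
    using eq by blast
qed

end
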